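(* Let $\alpha\in(0,1)$, $\beta\in(0,1-\alpha)$, $t\ge2$, $p_0\in[0,1]$, $\pi_0=\delta_{p_0}$ and $\mu_{p_0}=p_0(1-p_0)$. Consider testing $H_0:\pi=\delta_{p_0}$ versus $H_1:W_1(\pi,\delta_{p_0})\ge\epsilon$ from $X_1,\dots,X_n$ i.i.d. from $P_\pi$. Then the test $\psi_{LM}^\alpha=\max(\psi_1^{\alpha/2},\psi_2^{\alpha/2})$ (defined in the context) is optimal up to constants: $P_{\pi_0}^n(\psi^\alpha_{LM}(X)=1)\le\alpha$, and there is a constant $C$ such that $\sup_{\pi\in D:\,W_1(\pi,\pi_0)\ge\epsilon}P_\pi^n(\psi^\alpha_{LM}(X)=0)\le\beta$ whenever $\epsilon\ge C\,\epsilon_*(n,t,\pi_0)$. Furthermore, for $t\gtrsim\sqrt n$, the local critical separation satisfies $$\epsilon_*(n,t,\pi_0)\asymp\max\left(\frac1n,\ \frac{\mu_{p_0}^{1/2}}{t^{1/2}n^{1/4}}\right),$$ and for $t\lesssim\sqrt n$ it satisfies $$\epsilon_*(n,t,\pi_0)\asymp\max\left(\frac1n,\ \min\Big(\mu_{p_0},\ \frac{\mu_{p_0}^{1/2}}{t^{1/2}n^{1/4}}\Big)\right).$$ Here the constants $C$ and those implied in $\asymp$ depend only on $\alpha,\beta$ and on the constant in the relation $t\gtrsim\sqrt n$ or $t\lesssim\sqrt n$ (they are uniform in $p_0,t,n$ for $n$ large enough).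
   Context: $D$ is the set of all probability distributions on $[0,1]$. For $\pi\in D$, $P_\pi$ is the binomial mixture on $\{0,\dots,t\}$ with $P_\pi(\{j\})=E_{p\sim\pi}\big[\binom tj p^j(1-p)^{t-j}\big]$; $P_\pi^n$ is its $n$-fold product and $X=(X_1,\dots,X_n)$. $W_1$ is the 1-Wasserstein distance, so $W_1(\pi,\delta_{p_0})=E_{p\sim\pi}|p-p_0|$. Local critical separation: tests are maps $\psi:\{0,\dots,t\}^n\to\{0,1\}$, $\Psi(\pi_0)=\{\psi:P_{\pi_0}^n(\psi(X)=1)\le\alpha\}$, $R_*(\epsilon,\pi_0)=\inf_{\psi\in\Psi(\pi_0)}\sup_{\pi\in D:W_1(\pi,\pi_0)\ge\epsilon}P_\pi^n(\psi(X)=0)$ (supremum over the empty set is $0$), and $\epsilon_*(n,t,\pi_0)=\inf\{\epsilon:R_*(\epsilon,\pi_0)\le\beta\}$. Tests: normalized Kravchuk polynomials $\tilde K_m(x,p,t)=\binom tm^{-1}\sum_{v=0}^m(-1)^{m-v}\binom{t-x}{m-v}\binom xv p^{m-v}(1-p)^v$; explicitly $\tilde K_1(x,p,t)=\frac xt-p$ and $\tilde K_2(x,p,t)=(\frac xt-p)^2-\frac{(x/t)(1-x/t)}{t-1}$. Put $T_{m,p_0}(X)=\frac1n\sum_{i=1}^n\tilde K_m(X_i,p_0,t)$ and $\psi_m^{a}(X)=I\big(T_{m,p_0}(X)>q_a(P_{\pi_0},T_{m,p_0})\big)$ for $m=1,2$, where $q_a(P_{\pi_0},T)=\inf\{u:P_{\pi_0}^n(T(X)>u)\le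 a\}$. This is for $p_0\le1/2$; for $p_0>1/2$ the test is, by symmetry, the one above applied to the reflected data $t-X_i$ with $1-p_0$ in place of $p_0$. $a\lesssim b$ means $a\le Cb$ for some positive constant $C$ for all $n$ large enough; $a\gtrsim b$ means $b\lesssim a$; $a\asymp b$ means both. *)

theory Defs
  imports "HOL-Probability.Probability"
begin

abbreviation unit_borel :: "real measure" where
  "unit_borel \<equiv> restrict_space borel {0..1}"

definition mixing_dists :: "real measure set" where
  "mixing_dists = {\<pi>. prob_space \<pi> \<and> sets \<pi> = sets unit_borel}"

definition point_mass :: "real \<Rightarrow> real measure" where
  "point_mass p0 = return unit_borel p0"

definition couplings :: "real measure \<Rightarrow> real measure \<Rightarrow> (real \<times> real) measure set" where
  "couplings \<pi> \<rho> = {\<gamma>. sets \<gamma> = sets (\<pi> \<Otimes>\<^sub>M \<rho>) \<and> distr \<gamma> \<pi> fst = \<pi> \<and> distr \<gamma> \<rho> snd = \<rho>}"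

definition W1 :: "real measure \<Rightarrow> real measure \<Rightarrow> real" where
  "W1 \<pi> \<rho> = (INF \<gamma>\<in>couplings \<pi> \<rho>. \<integral>z. \<bar>fst z - snd z\<bar> \<partial>\<gamma>)"

definition binmix :: "nat \<Rightarrow> real measure \<Rightarrow> nat pmf" where
  "binmix t \<pi> = embed_pmf (\<lambda>j. \<integral>p. real (t choose j) * p ^ j * (1 - p) ^ (t - j) \<partial>\<pi>)"

text \<open>A sample of size \<open>n\<close> is a function on \<open>{..<n}\<close>, extended by \<open>0\<close> to all of \<open>nat\<close>.\<close>

definition samples :: "nat \<Rightarrow> nat \<Rightarrow> (nat \<Rightarrow> nat) set" where
  "samples n t = PiE_dflt {..<n} 0 (\<lambda>_. {0..t})"

definition binmix_prod :: "nat \<Rightarrow> nat \<Rightarrow> real measure \<Rightarrow> (nat \<Rightarrow> nat) pmf" where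
  "binmix_prod n t \<pi> = Pi_pmf {..<n} 0 (\<lambda>_. binmix t \<pi>)"

definition tests :: "nat \<Rightarrow> nat \<Rightarrow> ((nat \<Rightarrow> nat) \<Rightarrow> nat) set" where
  "tests n t = samples n t \<rightarrow> {0, 1}"

definition level_tests :: "real \<Rightarrow> nat \<Rightarrow> nat \<Rightarrow> real measure \<Rightarrow> ((nat \<Rightarrow> nat) \<Rightarrow> nat) set" where
  "level_tests \<alpha> n t \<pi>0 =
     {\<psi> \<in> tests n t. measure_pmf.prob (binmix_prod n t \<pi>0) {X. \<psi> X = 1} \<le> \<alpha>}"

text \<open>Inserting \<open>0\<close>, which is harmless for a set of probabilities, makes the supremum over the
  empty alternative equal to \<open>0\<close>; the \<open>Sup\<close> of the empty set of reals is unspecified.\<close>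

definition max_type2 ::
    "nat \<Rightarrow> nat \<Rightarrow> real measure \<Rightarrow> ((nat \<Rightarrow> nat) \<Rightarrow> nat) \<Rightarrow> real \<Rightarrow> real" where
  "max_type2 n t \<pi>0 \<psi> \<epsilon> = Sup (insert 0
     ((\<lambda>\<pi>. measure_pmf.prob (binmix_prod n t \<pi>) {X. \<psi> X = 0}) `
        {\<pi> \<in> mixing_dists. W1 \<pi> \<pi>0 \<ge> \<epsilon>}))"

definition local_risk :: "real \<Rightarrow> nat \<Rightarrow> nat \<Rightarrow> real \<Rightarrow> real measure \<Rightarrow> real" where
  "local_risk \<alpha> n t \<epsilon> \<pi>0 = (INF \<psi>\<in>level_tests \<alpha> n t \<pi>0. max_type2 n t \<pi>0 \<psi> \<epsilon>)"

definition crit_sep :: "real \<Rightarrow> real \<Rightarrow> nat \<Rightarrow> nat \<Rightarrow> real measure \<Rightarrow> real" where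
  "crit_sep \<alpha> \<beta> n t \<pi>0 = Inf {\<epsilon>. 0 \<le> \<epsilon> \<and> local_risk \<alpha> n t \<epsilon> \<pi>0 \<le> \<beta>}"

definition kravchuk :: "nat \<Rightarrow> nat \<Rightarrow> real \<Rightarrow> nat \<Rightarrow> real" where
  "kravchuk m x p t = inverse (real (t choose m)) *
     (\<Sum>v=0..m. (-1) ^ (m - v) * real ((t - x) choose (m - v)) * real (x choose v)
        * p ^ (m - v) * (1 - p) ^ v)"

definition kravchuk_stat :: "nat \<Rightarrow> nat \<Rightarrow> nat \<Rightarrow> real \<Rightarrow> (nat \<Rightarrow> nat) \<Rightarrow> real" where
  "kravchuk_stat n t m p0 X = (1 / real n) * (\<Sum>i<n. kravchuk m (X i) p0 t)"

definition upper_quantile :: "real \<Rightarrow> 'a pmf \<Rightarrow> ('a \<Rightarrow> real) \<Rightarrow> real" where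
  "upper_quantile a P T = Inf {u. measure_pmf.prob P {X. T X > u} \<le> a}"

definition psi :: "nat \<Rightarrow> nat \<Rightarrow> nat \<Rightarrow> real \<Rightarrow> real \<Rightarrow> (nat \<Rightarrow> nat) \<Rightarrow> nat" where
  "psi n t m a p0 X =
     (if kravchuk_stat n t m p0 X
           > upper_quantile a (binmix_prod n t (point_mass p0)) (kravchuk_stat n t m p0)
      then 1 else 0)"

definition psi_LM_lower :: "nat \<Rightarrow> nat \<Rightarrow> real \<Rightarrow> real \<Rightarrow> (nat \<Rightarrow> nat) \<Rightarrow> nat" where
  "psi_LM_lower n t \<alpha> p0 X = max (psi n t 1 (\<alpha> / 2) p0 X) (psi n t 2 (\<alpha> / 2) p0 X)"

definition psi_LM :: "nat \<Rightarrow> nat \<Rightarrow> real \<Rightarrow> real \<Rightarrow> (nat \<Rightarrow> nat) \<Rightarrow> nat" where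
  "psi_LM n t \<alpha> p0 X =
     (if p0 \<le> 1 / 2 then psi_LM_lower n t \<alpha> p0 X
      else psi_LM_lower n t \<alpha> (1 - p0) (\<lambda>i. t - X i))"

lemma mixing_dists_integrable:
  fixes f :: "real \<Rightarrow> real"
  assumes "\<pi> \<in> mixing_dists" "f \<in> borel_measurable borel" "\<And>p. p \<in> {0..1} \<Longrightarrow> \<bar>f p\<bar> \<le> B"
  shows "integrable \<pi> f"
proof -
  have P: "prob_space \<pi>" and S: "sets \<pi> = sets unit_borel"
    using assms(1) by (auto simp: mixing_dists_def)
  interpret prob_space \<pi> by (rule P)
  have sp: "space \<pi> = {0..1}"
    using sets_eq_imp_space_eq[OF S] by (simp add: space_restrict_space)
  have "f \<in> borel_measurable unit_borel"
    using assms(2) by (rule measurable_restrict_space1)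
  then have "f \<in> borel_measurable \<pi>"
    using S by (simp cong: measurable_cong_sets)
  then show ?thesis
    by (intro integrable_const_bound[of _ B]) (auto intro!: AE_I2 simp: sp assms(3))
qed

lemma point_mass_mixing_dists:
  assumes "p0 \<in> {0..1}" shows "point_mass p0 \<in> mixing_dists"
  using assms unfolding mixing_dists_def point_mass_def
  by (auto intro!: prob_space_return simp: space_restrict_space)

lemma pmf_binmix:
  assumes "\<pi> \<in> mixing_dists"
  shows "pmf (binmix t \<pi>) j = (\<integral>p. real (t choose j) * p ^ j * (1 - p) ^ (t - j) \<partial>\<pi>)"
proof -
  let ?f = "\<lambda>j p. real (t choose j) * p ^ j * (1 - p) ^ (t - j) :: real"
  have P: "prob_space \<pi>" and S: "sets \<pi> = sets unit_borel"
    using assms(1) by (auto simp: mixing_dists_def)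
  interpret prob_space \<pi> by (rule P)
  have sp: "space \<pi> = {0..1}"
    using sets_eq_imp_space_eq[OF S] by (simp add: space_restrict_space)
  have int: "integrable \<pi> (?f j)" for j
  proof (rule mixing_dists_integrable[OF assms, where B = "real (t choose j)"])
    show "?f j \<in> borel_measurable borel" by measurable
    fix p :: real assume p: "p \<in> {0..1}"
    then have "p ^ j * (1 - p) ^ (t - j) \<le> 1"
      by (intro mult_le_one power_le_one zero_le_power) auto
    moreover have "0 \<le> p ^ j * (1 - p) ^ (t - j)" using p by auto
    ultimately show "\<bar>?f j p\<bar> \<le> real (t choose j)"
      by (simp add: abs_mult mult.assoc mult_left_le)
  qed
  have nn: "0 \<le> (\<integral>p. ?f j p \<partial>\<pi>)" for j
    by (rule Bochner_Integration.integral_nonneg) (auto simp: sp)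
  have one: "(\<Sum>j\<le>t. ?f j p) = 1" for p :: real
    using binomial_ring[of p "1 - p" t] by simp
  have "(\<integral>\<^sup>+j. ennreal (\<integral>p. ?f j p \<partial>\<pi>) \<partial>count_space UNIV)
      = (\<Sum>j\<le>t. ennreal (\<integral>p. ?f j p \<partial>\<pi>))"
    by (rule nn_integral_count_space'[where A = "{..t}"]) (auto simp: not_le binomial_eq_0)
  also have "\<dots> = ennreal (\<Sum>j\<le>t. \<integral>p. ?f j p \<partial>\<pi>)"
    by (rule sum_ennreal) (rule nn)
  also have "(\<Sum>j\<le>t. \<integral>p. ?f j p \<partial>\<pi>) = (\<integral>p. (\<Sum>j\<le>t. ?f j p) \<partial>\<pi>)"
    by (rule Bochner_Integration.integral_sum[symmetric]) (rule int)
  also have "\<dots> = 1" by (simp only: one) (simp add: prob_space)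
  finally show ?thesis
    unfolding binmix_def by (intro pmf_embed_pmf) (auto intro: nn)
qed

lemma kravchuk_1:
  assumes "x \<le> t" "t \<ge> 1"
  shows "kravchuk 1 x p t = real x / real t - p"
  using assms by (simp add: kravchuk_def field_simps of_nat_diff)

lemma kravchuk_2:
  assumes "x \<le> t" "t \<ge> 2"
  shows "kravchuk 2 x p t = (x / t - p)\<^sup>2 - (x / t) * (1 - x / t) / (real t - 1)"
proof -
  have ch: "real (n choose 2) = real n * (real n - 1) / 2" for n
    by (cases n) (auto simp: choose_two real_of_nat_div algebra_simps)
  have "real t - 1 \<noteq> 0" "real t \<noteq> 0" using assms by auto
  then show ?thesis
    using assms
    by (simp add: kravchuk_def numeral_2_eq_2 ch[unfolded numeral_2_eq_2] of_nat_diff)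
       (simp add: field_simps power2_eq_square)
qed

lemma W1_point_mass:
  assumes "\<pi> \<in> mixing_dists" "p0 \<in> {0..1}"
  shows "W1 \<pi> (point_mass p0) = (\<integral>p. \<bar>p - p0\<bar> \<partial>\<pi>)"
proof -
  let ?\<delta> = "point_mass p0"
  have S: "sets \<pi> = sets unit_borel"
    using assms(1) by (auto simp: mixing_dists_def)
  have sp: "space \<pi> = {0..1}"
    using sets_eq_imp_space_eq[OF S] by (simp add: space_restrict_space)
  have S': "sets ?\<delta> = sets unit_borel" and sp': "space ?\<delta> = {0..1}"
    by (simp_all add: point_mass_def space_restrict_space)
  have id_meas: "(\<lambda>p. p) \<in> borel_measurable M" if "sets M = sets unit_borel" for M :: "real measure"
  proof -
    have "(\<lambda>p. p) \<in> borel_measurable unit_borel" by (rule measurable_restrict_space1) simp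
    then show ?thesis using that by (simp cong: measurable_cong_sets)
  qed
  note [measurable] = id_meas[OF S] id_meas[OF S']
  have const: "(\<integral>z. \<bar>fst z - snd z\<bar> \<partial>\<gamma>) = (\<integral>p. \<bar>p - p0\<bar> \<partial>\<pi>)"
    if "\<gamma> \<in> couplings \<pi> ?\<delta>" for \<gamma>
  proof -
    have sg: "sets \<gamma> = sets (\<pi> \<Otimes>\<^sub>M ?\<delta>)" and d1: "distr \<gamma> \<pi> fst = \<pi>"
      and d2: "distr \<gamma> ?\<delta> snd = ?\<delta>"
      using that by (auto simp: couplings_def)
    have m1: "fst \<in> \<gamma> \<rightarrow>\<^sub>M \<pi>" and m2: "snd \<in> \<gamma> \<rightarrow>\<^sub>M ?\<delta>"
      using sg by (auto cong: measurable_cong_sets)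
    have f1: "fst \<in> borel_measurable \<gamma>" and f2: "snd \<in> borel_measurable \<gamma>"
      using measurable_compose[OF m1 id_meas[OF S]] measurable_compose[OF m2 id_meas[OF S']] by auto
    have meas: "{q \<in> space ?\<delta>. q = p0} \<in> sets ?\<delta>" by measurable
    have "AE q in ?\<delta>. q = p0"
    proof -
      have "Measurable.pred ?\<delta> (\<lambda>q. q = p0)" by measurable
      then have "Measurable.pred unit_borel (\<lambda>q. q = p0)"
        using S' by (simp cong: measurable_cong_sets)
      then show ?thesis
        using assms(2) unfolding point_mass_def
        by (subst AE_return) (auto simp: space_restrict_space)
    qed
    then have "AE q in distr \<gamma> ?\<delta> snd. q = p0" by (simp only: d2)
    then have "AE z in \<gamma>. snd z = p0"
      using AE_distr_iff[OF m2 meas] by simp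
    then have "(\<integral>z. \<bar>fst z - snd z\<bar> \<partial>\<gamma>) = (\<integral>z. \<bar>fst z - p0\<bar> \<partial>\<gamma>)"
      using f1 f2 by (intro integral_cong_AE) auto
    also have "\<dots> = (\<integral>p. \<bar>p - p0\<bar> \<partial>distr \<gamma> \<pi> fst)"
      by (rule integral_distr[symmetric, OF m1]) measurable
    finally show ?thesis by (simp only: d1)
  qed
  have mp: "(\<lambda>p. (p, p0)) \<in> \<pi> \<rightarrow>\<^sub>M \<pi> \<Otimes>\<^sub>M ?\<delta>"
    using assms(2) by (intro measurable_Pair) (auto simp: sp')
  have mc: "(\<lambda>_. p0) \<in> \<pi> \<rightarrow>\<^sub>M ?\<delta>" using assms(2) by (auto simp: sp')
  have "distr \<pi> ?\<delta> (\<lambda>_. p0) = ?\<delta>"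
  proof -
    have "prob_space \<pi>" using assms(1) by (simp add: mixing_dists_def)
    then have "distr \<pi> ?\<delta> (\<lambda>_. p0) = return ?\<delta> p0"
      using assms(2) sp' by (intro prob_space.distr_const) auto
    also have "\<dots> = ?\<delta>" unfolding point_mass_def by (rule return_cong) simp
    finally show ?thesis .
  qed
  then have "distr \<pi> (\<pi> \<Otimes>\<^sub>M ?\<delta>) (\<lambda>p. (p, p0)) \<in> couplings \<pi> ?\<delta>"
    by (simp add: couplings_def distr_distr[OF _ mp] o_def)
  then have "couplings \<pi> ?\<delta> \<noteq> {}" by auto
  then show ?thesis unfolding W1_def by (simp add: const)
qed

end

theory Submission
  imports Defs
begin

text \<open>
  Throughout, \<open>\<mu> = p0 (1 - p0)\<close>. Both regimes of \<open>t\<close> are governed by the single rate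
  \<open>r = max (1 / n) (min \<mu> (\<surd>\<mu> / (\<surd>t n\<^sup>1\<^sup>/\<^sup>4)))\<close>, called \<open>rate\<close>: for \<open>t \<ge> c \<surd>n\<close> it agrees, up to a
  constant, with the expression without the minimum (\<open>rate_le_for_large_t\<close>). The statement follows
  from two facts that hold for all \<open>n \<ge> 1\<close>, \<open>t \<ge> 2\<close> and \<open>p0\<close>: the test has type II error at most \<open>\<beta>\<close> from
  separation \<open>2 C r\<close> on (\<open>max_type2_psi_LM_le\<close>), and no test of level \<open>\<alpha>\<close> achieves this below
  a small multiple of \<open>r\<close> (\<open>local_risk_gt_below_rate\<close>).

  Upper bound. A sample from the mixture is obtained by drawing \<open>p\<^sub>i\<close> independently from \<open>\<pi>\<close> and
  then \<open>X\<^sub>i\<close> from the binomial distribution with parameter \<open>p\<^sub>i\<close> (\<open>prob_binmix_prod_eq_integral\<close>). A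
  Chebyshev bound for the whole mixture would be too weak for the quadratic statistic, because rare large
  deviations of \<open>p\<close> dominate its variance. Conditionally on the \<open>p\<^sub>i\<close> this effect is absent, and all that
  is needed about them is that the mean \<open>S\<close> of \<open>\<bar>p\<^sub>i - p0\<bar>\<close> is at least half of its expectation
  \<open>W\<close>. That holds with high probability, because the variance of \<open>S\<close> is at most \<open>W / n\<close> and \<open>W\<close> is at least
  a large multiple of \<open>1 / n\<close>. Assume \<open>p0 \<le> 1 / 2\<close>; the other case is its reflection. If the mean of \<open>p\<^sub>i - p0\<close> is
  at least \<open>S / 2\<close>, the linear statistic rejects (\<open>psi_1_type2\<close>). Otherwise the deviations below \<open>p0\<close>, which
  cannot exceed \<open>p0 \<le> 2 \<mu>\<close>, account for a fixed part of \<open>S\<close>, so \<open>S < 8 \<mu>\<close>; then \<open>r\<close> is at least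
  \<open>\<surd>\<mu> / (\<surd>t n\<^sup>1\<^sup>/\<^sup>4)\<close>, and the quadratic statistic, with mean at least \<open>S\<^sup>2\<close> and null
  standard deviation of order \<open>\<mu> / (t \<surd>n)\<close>, rejects (\<open>psi_2_type2\<close>).

  Lower bound. A contamination of mass of order \<open>1 / n\<close> at the farther end point of the unit interval remains
  unobserved with probability close to one (\<open>contamination_close\<close>). The symmetric two-point distribution on
  \<open>p0 \<plusminus> h\<close> matches the mean of the null hypothesis, and the chi-square divergence of the samples is of
  order \<open>n (t h\<^sup>2 / \<mu>)\<^sup>2\<close> (\<open>symmetric_pair_close\<close>).
\<close>

section \<open>Chebyshev bounds for averages of independent variables\<close>

lemma (in prob_space) expectation_square_sum_indep:
  fixes Y :: "'i \<Rightarrow> 'a \<Rightarrow> real"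
  assumes "finite I" "indep_vars (\<lambda>_. borel) Y I"
    and int: "\<And>i. i \<in> I \<Longrightarrow> integrable M (Y i)"
    and int2: "\<And>i. i \<in> I \<Longrightarrow> integrable M (\<lambda>x. (Y i x)\<^sup>2)"
    and zero: "\<And>i. i \<in> I \<Longrightarrow> expectation (Y i) = 0"
  shows "integrable M (\<lambda>x. (\<Sum>i\<in>I. Y i x)\<^sup>2) \<and>
         expectation (\<lambda>x. (\<Sum>i\<in>I. Y i x)\<^sup>2) = (\<Sum>i\<in>I. expectation (\<lambda>x. (Y i x)\<^sup>2))"
  using assms
proof (induction I rule: finite_induct)
  case empty
  then show ?case by simp
next
  case (insert i I)
  let ?S = "\<lambda>x. \<Sum>j\<in>I. Y j x"
  have IH: "integrable M (\<lambda>x. (?S x)\<^sup>2)"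
    "expectation (\<lambda>x. (?S x)\<^sup>2) = (\<Sum>i\<in>I. expectation (\<lambda>x. (Y i x)\<^sup>2))"
    using insert.IH insert.prems by (auto intro: indep_vars_subset)
  have ind: "indep_var borel (Y i) borel ?S"
    using insert.hyps insert.prems(1) by (intro indep_vars_sum) auto
  have iS: "integrable M ?S"
    using insert.prems by (intro Bochner_Integration.integrable_sum) auto
  have iY: "integrable M (Y i)" "integrable M (\<lambda>x. (Y i x)\<^sup>2)"
    using insert.prems by auto
  have cross: "integrable M (\<lambda>x. Y i x * ?S x)"
    by (rule indep_var_integrable[OF ind iY(1) iS])
  have cross0: "expectation (\<lambda>x. Y i x * ?S x) = 0"
    using indep_var_lebesgue_integral[OF ind iY(1) iS] insert.prems(4)[of i] by simp
  have eq: "(\<lambda>x. (\<Sum>j\<in>insert i I. Y j x)\<^sup>2) = (\<lambda>x. ((Y i x)\<^sup>2 + 2 * (Y i x * ?S x)) + (?S x)\<^sup>2)"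
    using insert.hyps by (auto simp: power2_eq_square algebra_simps)
  show ?case
    unfolding eq using iY cross IH(1) insert.hyps
    by (simp add: cross0 IH(2))
qed

lemma (in prob_space) second_moment_bound:
  fixes Z :: "'a \<Rightarrow> real"
  assumes "integrable M (\<lambda>x. (Z x)\<^sup>2)" "Z \<in> borel_measurable M" "a > 0"
  shows "prob {x \<in> space M. \<bar>Z x\<bar> \<ge> a} \<le> expectation (\<lambda>x. (Z x)\<^sup>2) / a\<^sup>2"
proof -
  have "{x \<in> space M. \<bar>Z x\<bar> \<ge> a} = {x \<in> space M. a\<^sup>2 \<le> (Z x)\<^sup>2}"
    using assms(3) by (auto simp: abs_le_square_iff[symmetric])
  then show ?thesis
    using integral_Markov_inequality_measure[OF assms(1), of "{}" "a\<^sup>2"] assms by simp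
qed

lemma (in prob_space) Chebyshev_average_indep:
  fixes Y :: "nat \<Rightarrow> 'a \<Rightarrow> real"
  assumes ind: "indep_vars (\<lambda>_. borel) Y {..<n}"
    and bnd: "\<And>i. i < n \<Longrightarrow> AE x in M. \<bar>Y i x\<bar> \<le> B"
    and mean: "\<And>i. i < n \<Longrightarrow> expectation (Y i) = m i"
    and "n \<ge> 1" "a > 0"
  shows "prob {x \<in> space M. \<bar>(1 / real n) * (\<Sum>i<n. Y i x) - (1 / real n) * (\<Sum>i<n. m i)\<bar> \<ge> a}
    \<le> (\<Sum>i<n. expectation (\<lambda>x. (Y i x - m i)\<^sup>2)) / (real n)\<^sup>2 / a\<^sup>2"
proof -
  have meas: "Y i \<in> borel_measurable M" if "i < n" for i
    using ind that unfolding indep_vars_def by auto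
  have int: "integrable M (Y i)" if "i < n" for i
    using meas[OF that] bnd[OF that] by (intro integrable_const_bound[of _ B]) auto
  have int2: "integrable M (\<lambda>x. (Y i x - m i)\<^sup>2)" if "i < n" for i
  proof (rule integrable_const_bound[of _ "(B + \<bar>m i\<bar>)\<^sup>2"])
    show "AE x in M. norm ((Y i x - m i)\<^sup>2) \<le> (B + \<bar>m i\<bar>)\<^sup>2"
      using bnd[OF that]
    proof eventually_elim
      case (elim x)
      then have "\<bar>Y i x - m i\<bar>\<^sup>2 \<le> (B + \<bar>m i\<bar>)\<^sup>2"
        by (intro power_mono) auto
      then show ?case by simp
    qed
  qed (use meas[OF that] in measurable)
  let ?Z = "\<lambda>x. \<Sum>i<n. (Y i x - m i)"
  have *: "integrable M (\<lambda>x. (?Z x)\<^sup>2) \<and>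
      expectation (\<lambda>x. (?Z x)\<^sup>2) = (\<Sum>i<n. expectation (\<lambda>x. (Y i x - m i)\<^sup>2))"
  proof (rule expectation_square_sum_indep)
    show "indep_vars (\<lambda>_. borel) (\<lambda>i x. Y i x - m i) {..<n}"
      by (rule indep_vars_compose2[OF ind]) auto
  qed (use int int2 mean in \<open>auto simp: prob_space\<close>)
  have zm: "?Z \<in> borel_measurable M"
    using meas by (intro borel_measurable_sum) auto
  have "{x \<in> space M. \<bar>(1 / real n) * (\<Sum>i<n. Y i x) - (1 / real n) * (\<Sum>i<n. m i)\<bar> \<ge> a}
      = {x \<in> space M. real n * a \<le> \<bar>?Z x\<bar>}"
  proof -
    have "(1 / real n) * (\<Sum>i<n. Y i x) - (1 / real n) * (\<Sum>i<n. m i) = ?Z x / real n" for x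
      by (simp add: sum_subtractf diff_divide_distrib)
    then have "\<bar>(1 / real n) * (\<Sum>i<n. Y i x) - (1 / real n) * (\<Sum>i<n. m i)\<bar> = \<bar>?Z x\<bar> / real n" for x
      by (simp add: abs_divide)
    moreover have "a \<le> \<bar>?Z x\<bar> / real n \<longleftrightarrow> real n * a \<le> \<bar>?Z x\<bar>" for x
      using assms(4) by (simp add: pos_le_divide_eq mult.commute)
    ultimately show ?thesis by presburger
  qed
  note set_eq = this
  have le: "prob {x \<in> space M. real n * a \<le> \<bar>?Z x\<bar>}
      \<le> expectation (\<lambda>x. (?Z x)\<^sup>2) / (real n * a)\<^sup>2"
    using second_moment_bound[of ?Z "real n * a"] * zm assms(4,5) by simp
  have eq: "expectation (\<lambda>x. (?Z x)\<^sup>2) / (real n * a)\<^sup>2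
      = (\<Sum>i<n. expectation (\<lambda>x. (Y i x - m i)\<^sup>2)) / (real n)\<^sup>2 / a\<^sup>2"
    using * by (simp add: power_mult_distrib)
  show ?thesis unfolding set_eq by (rule ord_le_eq_trans[OF le eq])
qed

lemma Chebyshev_average_Pi_pmf:
  fixes f :: "'b \<Rightarrow> real"
  assumes fin: "\<And>i. i < n \<Longrightarrow> finite (set_pmf (P i))"
    and mean: "\<And>i. i < n \<Longrightarrow> measure_pmf.expectation (P i) f = m i"
    and "n \<ge> 1" "a > 0"
  shows "measure_pmf.prob (Pi_pmf {..<n} d P)
      {X. \<bar>(1 / real n) * (\<Sum>i<n. f (X i)) - (1 / real n) * (\<Sum>i<n. m i)\<bar> \<ge> a}
    \<le> (\<Sum>i<n. measure_pmf.expectation (P i) (\<lambda>x. (f x - m i)\<^sup>2)) / (real n)\<^sup>2 / a\<^sup>2"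
proof -
  let ?M = "measure_pmf (Pi_pmf {..<n} d P)"
  have comp: "measure_pmf.expectation (Pi_pmf {..<n} d P) (\<lambda>X. g (X i)) = measure_pmf.expectation (P i) g"
    if "i < n" for i and g :: "'b \<Rightarrow> real"
  proof -
    have "P i = map_pmf (\<lambda>X. X i) (Pi_pmf {..<n} d P)"
      using that by (subst Pi_pmf_component) auto
    from arg_cong[OF this, of "\<lambda>q. measure_pmf.expectation q g"] show ?thesis
      by (simp only: integral_map_pmf)
  qed
  let ?V = "\<Union>i<n. set_pmf (P i)"
  have finV: "finite ?V" using fin by auto
  have "measure_pmf.prob (Pi_pmf {..<n} d P)
      {X \<in> space ?M. \<bar>(1 / real n) * (\<Sum>i<n. f (X i)) - (1 / real n) * (\<Sum>i<n. m i)\<bar> \<ge> a}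
    \<le> (\<Sum>i<n. measure_pmf.expectation (Pi_pmf {..<n} d P) (\<lambda>X. (f (X i) - m i)\<^sup>2)) / (real n)\<^sup>2 / a\<^sup>2"
  proof (rule measure_pmf.Chebyshev_average_indep[where B = "Max (insert 0 ((\<lambda>x. \<bar>f x\<bar>) ` ?V))"])
    show "prob_space.indep_vars ?M (\<lambda>_. borel) (\<lambda>i X. f (X i)) {..<n}"
      by (rule prob_space.indep_vars_compose2[OF _ indep_vars_Pi_pmf])
         (auto simp: measure_pmf.prob_space_axioms)
    fix i assume i: "i < n"
    show "AE X in ?M. \<bar>f (X i)\<bar> \<le> Max (insert 0 ((\<lambda>x. \<bar>f x\<bar>) ` ?V))"
    proof (rule AE_pmfI)
      fix X assume "X \<in> set_pmf (Pi_pmf {..<n} d P)"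
      then have "X i \<in> set_pmf (P i)" using i by (auto simp: set_Pi_pmf PiE_dflt_def)
      then show "\<bar>f (X i)\<bar> \<le> Max (insert 0 ((\<lambda>x. \<bar>f x\<bar>) ` ?V))"
        using finV i by (intro Max_ge) auto
    qed
    show "measure_pmf.expectation (Pi_pmf {..<n} d P) (\<lambda>X. f (X i)) = m i"
      using comp[OF i] mean[OF i] by simp
  qed (use assms in auto)
  also have "(\<Sum>i<n. measure_pmf.expectation (Pi_pmf {..<n} d P) (\<lambda>X. (f (X i) - m i)\<^sup>2))
      = (\<Sum>i<n. measure_pmf.expectation (P i) (\<lambda>x. (f x - m i)\<^sup>2))"
    by (intro sum.cong refl comp) auto
  finally show ?thesis by simp
qed

section \<open>Binomial moments of the Kravchuk polynomials\<close>

lemma expectation_binomial_choose: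
  assumes p: "p \<in> {0..1}"
  shows "measure_pmf.expectation (binomial_pmf t p) (\<lambda>x. real (x choose k)) = real (t choose k) * p ^ k"
proof (cases "k \<le> t")
  case False
  have "measure_pmf.expectation (binomial_pmf t p) (\<lambda>x. real (x choose k)) = 0"
    using False by (subst expectation_binomial_pmf'[OF p]) (auto intro!: sum.neutral)
  then show ?thesis using False by simp
next
  case True
  let ?f = "\<lambda>x. real (x choose k) * (real (t choose x) * p ^ x * (1 - p) ^ (t - x))"
  have "measure_pmf.expectation (binomial_pmf t p) (\<lambda>x. real (x choose k)) = (\<Sum>x\<le>t. ?f x)"
    by (subst expectation_binomial_pmf'[OF p]) (simp add: algebra_simps)
  also have "\<dots> = (\<Sum>x\<in>{k..t}. ?f x)"
    by (rule sum.mono_neutral_right) auto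
  also have "\<dots> = (\<Sum>y\<le>t - k. ?f (y + k))"
    using True by (intro sum.reindex_bij_witness[of _ "\<lambda>y. y + k" "\<lambda>x. x - k"]) auto
  also have "\<dots> = (\<Sum>y\<le>t - k. real (t choose k) * p ^ k * (real (t - k choose y) * p ^ y * (1 - p) ^ (t - k - y)))"
  proof (rule sum.cong)
    fix y assume "y \<in> {..t - k}"
    then have "(t choose (y + k)) * ((y + k) choose k) = (t choose k) * ((t - k) choose y)"
      using choose_mult[of k "y + k" t] True by simp
    then have E: "real (t choose (y + k)) * real ((y + k) choose k) = real (t choose k) * real ((t - k) choose y)"
      by (metis of_nat_mult)
    have "?f (y + k) = (real (t choose k) * real ((t - k) choose y)) * p ^ (y + k) * (1 - p) ^ (t - (y + k))"
      unfolding E[symmetric] by (simp only: mult_ac)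
    then show "?f (y + k) = real (t choose k) * p ^ k * (real (t - k choose y) * p ^ y * (1 - p) ^ (t - k - y))"
      by (simp add: power_add algebra_simps)
  qed simp
  also have "\<dots> = real (t choose k) * p ^ k * (p + (1 - p)) ^ (t - k)"
    by (subst binomial_ring) (simp add: sum_distrib_left)
  finally show ?thesis by simp
qed

lemma real_choose_falling:
  "real x = real (x choose 1)"
  "real x * (real x - 1) = 2 * real (x choose 2)"
  "real x * (real x - 1) * (real x - 2) = 6 * real (x choose 3)"
  "real x * (real x - 1) * (real x - 2) * (real x - 3) = 24 * real (x choose 4)"
  by (simp_all add: binomial_gbinomial gbinomial_prod_rev eval_nat_numeral atLeast0_lessThan_Suc)

lemma expectation_binomial_falling:
  fixes p :: real and t :: nat
  assumes p: "p \<in> {0..1}"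
  defines "E \<equiv> measure_pmf.expectation (binomial_pmf t p)"
  shows "E (\<lambda>x. real x) = real t * p"
    "E (\<lambda>x. real x * (real x - 1)) = real t * (real t - 1) * p\<^sup>2"
    "E (\<lambda>x. real x * (real x - 1) * (real x - 2)) = real t * (real t - 1) * (real t - 2) * p ^ 3"
    "E (\<lambda>x. real x * (real x - 1) * (real x - 2) * (real x - 3)) =
       real t * (real t - 1) * (real t - 2) * (real t - 3) * p ^ 4"
proof -
  note m = expectation_binomial_choose[OF p, of t]
  show "E (\<lambda>x. real x) = real t * p" using m[of 1] by (simp add: E_def)
  show "E (\<lambda>x. real x * (real x - 1)) = real t * (real t - 1) * p\<^sup>2"
    unfolding E_def real_choose_falling(2) by (simp add: m)
  show "E (\<lambda>x. real x * (real x - 1) * (real x - 2)) = real t * (real t - 1) * (real t - 2) * p ^ 3"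
    unfolding E_def real_choose_falling(3) by (simp add: m)
  show "E (\<lambda>x. real x * (real x - 1) * (real x - 2) * (real x - 3)) =
       real t * (real t - 1) * (real t - 2) * (real t - 3) * p ^ 4"
    unfolding E_def real_choose_falling(4) by (simp add: m)
qed

lemma expectation_binomial_cong:
  assumes p: "p \<in> {0..1}" and "\<And>x. x \<le> t \<Longrightarrow> f x = g x"
  shows "measure_pmf.expectation (binomial_pmf t p) f = (measure_pmf.expectation (binomial_pmf t p) g :: real)"
  using assms(2) by (simp add: expectation_binomial_pmf'[OF p])

lemma kravchuk_1_moments:
  assumes p: "p \<in> {0..1}" and t: "t \<ge> 1"
  shows "measure_pmf.expectation (binomial_pmf t p) (\<lambda>x. kravchuk 1 x p0 t) = p - p0"
    and "measure_pmf.expectation (binomial_pmf t p) (\<lambda>x. (kravchuk 1 x p0 t - (p - p0))\<^sup>2) = p * (1 - p) / real t"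
proof -
  note m = expectation_binomial_falling[OF p, of t]
  have "measure_pmf.expectation (binomial_pmf t p) (\<lambda>x. kravchuk 1 x p0 t)
      = measure_pmf.expectation (binomial_pmf t p) (\<lambda>x. real x / real t - p0)"
    using t by (intro expectation_binomial_cong[OF p]) (simp add: kravchuk_1[simplified])
  also have "\<dots> = p - p0" using m(1) p t by simp
  finally show "measure_pmf.expectation (binomial_pmf t p) (\<lambda>x. kravchuk 1 x p0 t) = p - p0" .
  have "measure_pmf.expectation (binomial_pmf t p) (\<lambda>x. (kravchuk 1 x p0 t - (p - p0))\<^sup>2)
      = measure_pmf.expectation (binomial_pmf t p) (\<lambda>x.
          (1 / (real t)\<^sup>2) * (real x * (real x - 1)) + ((1 - 2 * real t * p) / (real t)\<^sup>2) * real x + p\<^sup>2)"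
    using t by (intro expectation_binomial_cong[OF p])
      (simp add: kravchuk_1[simplified] field_simps power2_eq_square)
  also have "\<dots> = (1 / (real t)\<^sup>2) * (real t * (real t - 1) * p\<^sup>2) + ((1 - 2 * real t * p) / (real t)\<^sup>2) * (real t * p) + p\<^sup>2"
    using m p by simp
  also have "\<dots> = p * (1 - p) / real t"
    using t by (simp add: field_simps power2_eq_square)
  finally show "measure_pmf.expectation (binomial_pmf t p) (\<lambda>x. (kravchuk 1 x p0 t - (p - p0))\<^sup>2) = p * (1 - p) / real t" .
qed

lemma kravchuk_2_falling:
  assumes "x \<le> t" "t \<ge> 2"
  shows "kravchuk 2 x p0 t = (real x * (real x - 1) - 2 * p0 * (real t - 1) * real x
      + p0\<^sup>2 * real t * (real t - 1)) / (real t * (real t - 1))"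
proof -
  have "real t - 1 \<noteq> 0" "real t \<noteq> 0" using assms by auto
  then show ?thesis
    unfolding kravchuk_2[OF assms] by (simp add: field_simps power2_eq_square)
qed

text \<open>
  The second Kravchuk polynomial is an unbiased estimator of \<open>(p - p0)\<^sup>2\<close>. Its variance is
  computed by expanding the square in falling factorials, whose binomial expectations are
  known. The two summands of the variance are those of the orthogonal decomposition
  \<open>K\<^sub>2(x, p0) = K\<^sub>2(x, p) + 2 d K\<^sub>1(x, p) + d\<^sup>2\<close>.
\<close>

lemma kravchuk_2_moments:
  fixes t :: nat and p p0 :: real
  assumes p: "p \<in> {0..1}" and t: "t \<ge> 2"
  defines "d \<equiv> p - p0" and "v \<equiv> p * (1 - p)"
  shows "measure_pmf.expectation (binomial_pmf t p) (\<lambda>x. kravchuk 2 x p0 t) = d\<^sup>2"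
    and "measure_pmf.expectation (binomial_pmf t p) (\<lambda>x. (kravchuk 2 x p0 t - d\<^sup>2)\<^sup>2)
      = 2 * v\<^sup>2 / (real t * (real t - 1)) + 4 * d\<^sup>2 * v / real t"
proof -
  note m = expectation_binomial_falling[OF p, of t]
  define T where "T = real t"
  have T: "T \<noteq> 0" "T - 1 \<noteq> 0" using t by (auto simp: T_def)
  have "measure_pmf.expectation (binomial_pmf t p) (\<lambda>x. kravchuk 2 x p0 t)
      = measure_pmf.expectation (binomial_pmf t p) (\<lambda>x.
         (1 / (T * (T - 1))) * (real x * (real x - 1)) + (- 2 * p0 / T) * real x + p0\<^sup>2)"
    using t T by (intro expectation_binomial_cong[OF p])
      (simp add: kravchuk_2_falling T_def[symmetric] field_simps)
  also have "\<dots> = (1 / (T * (T - 1))) * (T * (T - 1) * p\<^sup>2) + (- 2 * p0 / T) * (T * p) + p0\<^sup>2"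
    using m p by (simp add: T_def[symmetric])
  also have "\<dots> = d\<^sup>2" using T by (simp add: d_def power2_diff)
  finally show "measure_pmf.expectation (binomial_pmf t p) (\<lambda>x. kravchuk 2 x p0 t) = d\<^sup>2" .
  define c where "c = (p0\<^sup>2 - d\<^sup>2) * T * (T - 1)"
  \<comment> \<open>\<open>a3\<close>, \<open>a2\<close>, \<open>a1\<close> are the coefficients of the falling factorials of orders 3, 2, 1\<close>
  define a3 where "a3 = 4 - 4 * p0 * (T - 1)"
  define a2 where "a2 = 2 + 4 * p0\<^sup>2 * (T - 1)\<^sup>2 - 8 * p0 * (T - 1) + 2 * c"
  define a1 where "a1 = 4 * p0\<^sup>2 * (T - 1)\<^sup>2 - 4 * c * p0 * (T - 1)"
  define D where "D = (T * (T - 1))\<^sup>2"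
  have D: "D \<noteq> 0" using T by (simp add: D_def)
  have "measure_pmf.expectation (binomial_pmf t p) (\<lambda>x. (kravchuk 2 x p0 t - d\<^sup>2)\<^sup>2)
      = measure_pmf.expectation (binomial_pmf t p) (\<lambda>x.
         (1 / D) * (real x * (real x - 1) * (real x - 2) * (real x - 3))
       + (a3 / D) * (real x * (real x - 1) * (real x - 2))
       + (a2 / D) * (real x * (real x - 1))
       + (a1 / D) * real x + c\<^sup>2 / D)"
  proof (rule expectation_binomial_cong[OF p])
    fix x assume x: "x \<le> t"
    define y where "y = real x"
    have "kravchuk 2 x p0 t - d\<^sup>2 = (y * (y - 1) - 2 * p0 * (T - 1) * y + c) / (T * (T - 1))"
      unfolding kravchuk_2_falling[OF x t] T_def[symmetric] y_def[symmetric] c_def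
      using T by (simp add: divide_simps) (simp add: algebra_simps)
    then have "(kravchuk 2 x p0 t - d\<^sup>2)\<^sup>2 = (y * (y - 1) - 2 * p0 * (T - 1) * y + c)\<^sup>2 / D"
      by (simp add: D_def power_divide)
    also have "\<dots> = (y * (y - 1) * (y - 2) * (y - 3) + a3 * (y * (y - 1) * (y - 2))
       + a2 * (y * (y - 1))
       + a1 * y + c\<^sup>2) / D"
    proof -
      have "(y * (y - 1) - 2 * p0 * (T - 1) * y + c)\<^sup>2 =
       y * (y - 1) * (y - 2) * (y - 3) + a3 * (y * (y - 1) * (y - 2))
       + a2 * (y * (y - 1))
       + a1 * y + c\<^sup>2"
        unfolding a1_def a2_def a3_def by (simp add: algebra_simps power2_eq_square)
      then show ?thesis by simp
    qed
    finally show "(kravchuk 2 x p0 t - d\<^sup>2)\<^sup>2 =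
         (1 / D) * (real x * (real x - 1) * (real x - 2) * (real x - 3))
       + (a3 / D) * (real x * (real x - 1) * (real x - 2))
       + (a2 / D) * (real x * (real x - 1))
       + (a1 / D) * real x + c\<^sup>2 / D"
      unfolding y_def by (simp add: add_divide_distrib)
  qed
  also have "\<dots> = (1 / D) * (T * (T - 1) * (T - 2) * (T - 3) * p ^ 4)
       + (a3 / D) * (T * (T - 1) * (T - 2) * p ^ 3)
       + (a2 / D) * (T * (T - 1) * p\<^sup>2)
       + (a1 / D) * (T * p) + c\<^sup>2 / D"
    using m p by (simp add: T_def[symmetric])
  also have "\<dots> = (T * (T - 1) * (T - 2) * (T - 3) * p ^ 4
       + a3 * (T * (T - 1) * (T - 2) * p ^ 3)
       + a2 * (T * (T - 1) * p\<^sup>2)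
       + a1 * (T * p) + c\<^sup>2) / D"
    by (simp add: add_divide_distrib)
  also have "\<dots> = (2 * v\<^sup>2 * (T * (T - 1)) + 4 * d\<^sup>2 * v * T * (T - 1)\<^sup>2) / D"
  proof -
    have c_eq: "c = (p * (2 * p0 - p)) * T * (T - 1)"
      by (simp add: c_def d_def algebra_simps power2_eq_square)
    have "T * (T - 1) * (T - 2) * (T - 3) * p ^ 4
       + a3 * (T * (T - 1) * (T - 2) * p ^ 3)
       + a2 * (T * (T - 1) * p\<^sup>2)
       + a1 * (T * p) + c\<^sup>2
      = 2 * v\<^sup>2 * (T * (T - 1)) + 4 * d\<^sup>2 * v * T * (T - 1)\<^sup>2"
      unfolding a1_def a2_def a3_def c_eq d_def v_def
      by (simp add: algebra_simps power2_eq_square power3_eq_cube power4_eq_xxxx)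
    then show ?thesis by simp
  qed
  also have "\<dots> = 2 * v\<^sup>2 / (T * (T - 1)) + 4 * d\<^sup>2 * v / T"
  proof -
    have "2 * v\<^sup>2 * (T * (T - 1)) / D = 2 * v\<^sup>2 / (T * (T - 1))"
      using T by (simp add: D_def power2_eq_square)
    moreover have "4 * d\<^sup>2 * v * T * (T - 1)\<^sup>2 / D = 4 * d\<^sup>2 * v / T"
      using T by (simp add: D_def power2_eq_square)
    ultimately show ?thesis by (simp add: add_divide_distrib)
  qed
  finally show "measure_pmf.expectation (binomial_pmf t p) (\<lambda>x. (kravchuk 2 x p0 t - d\<^sup>2)\<^sup>2)
      = 2 * v\<^sup>2 / (real t * (real t - 1)) + 4 * d\<^sup>2 * v / real t" by (simp add: T_def)
qed

section \<open>Mixture samples as averages of products of binomials\<close>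

text \<open>
  Independent observations with individual success probabilities: the conditional law of the
  sample given the realised mixing values \<open>p 0, \<dots>, p (n - 1)\<close>. It is meaningful only when these
  values lie in the unit interval.
\<close>

definition bin_prod :: "nat \<Rightarrow> nat \<Rightarrow> (nat \<Rightarrow> real) \<Rightarrow> (nat \<Rightarrow> nat) pmf" where
  "bin_prod n t p = Pi_pmf {..<n} 0 (\<lambda>i. binomial_pmf t (p i))"

lemma finite_samples: "finite (samples n t)"
  unfolding samples_def by (intro finite_PiE_dflt) auto

lemma mixing_distsD:
  assumes "\<pi> \<in> mixing_dists"
  shows "prob_space \<pi>" "sets \<pi> = sets unit_borel" "space \<pi> = {0..1}"
  using assms sets_eq_imp_space_eq[of \<pi> unit_borel]
  by (auto simp: mixing_dists_def space_restrict_space)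

lemma mixing_dists_measurable:
  fixes f :: "real \<Rightarrow> real"
  assumes "\<pi> \<in> mixing_dists" "f \<in> borel_measurable borel"
  shows "f \<in> borel_measurable \<pi>"
  using measurable_restrict_space1[OF assms(2), of "{0..1}"] mixing_distsD(2)[OF assms(1)]
  by (simp cong: measurable_cong_sets)

lemma set_pmf_binmix:
  assumes "\<pi> \<in> mixing_dists"
  shows "set_pmf (binmix t \<pi>) \<subseteq> {0..t}"
  by (auto simp: set_pmf_eq pmf_binmix[OF assms] not_le intro: ccontr)

lemma set_pmf_binmix_prod:
  assumes "\<pi> \<in> mixing_dists"
  shows "set_pmf (binmix_prod n t \<pi>) \<subseteq> samples n t"
  using set_pmf_binmix[OF assms, of t]
  by (fastforce simp: binmix_prod_def samples_def set_Pi_pmf PiE_dflt_def)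

lemma set_pmf_binomial_subset: "p \<in> {0..1} \<Longrightarrow> set_pmf (binomial_pmf t p) \<subseteq> {0..t}"
  by (auto simp: set_pmf_binomial_eq split: if_splits)

lemma set_pmf_bin_prod:
  assumes "\<And>i. i < n \<Longrightarrow> p i \<in> {0..1}"
  shows "set_pmf (bin_prod n t p) \<subseteq> samples n t"
  using set_pmf_binomial_subset[OF assms]
  by (fastforce simp: bin_prod_def samples_def set_Pi_pmf PiE_dflt_def)

lemma binmix_point_mass:
  assumes "p \<in> {0..1}"
  shows "binmix t (point_mass p) = binomial_pmf t p"
proof (rule pmf_eqI)
  fix j
  have "(\<lambda>q. real (t choose j) * q ^ j * (1 - q) ^ (t - j)) \<in> borel_measurable unit_borel"
    by (rule measurable_restrict_space1) measurable
  then show "pmf (binmix t (point_mass p)) j = pmf (binomial_pmf t p) j"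
    using assms unfolding pmf_binmix[OF point_mass_mixing_dists[OF assms]]
    by (simp add: point_mass_def integral_return space_restrict_space)
qed

lemma binmix_prod_point_mass:
  assumes "p \<in> {0..1}"
  shows "binmix_prod n t (point_mass p) = bin_prod n t (\<lambda>_. p)"
  by (simp add: binmix_prod_def bin_prod_def binmix_point_mass[OF assms])

lemma prob_eq_sum_samples:
  assumes "set_pmf Q \<subseteq> samples n t"
  shows "measure_pmf.prob Q A = (\<Sum>X\<in>samples n t \<inter> A. pmf Q X)"
proof -
  have "measure_pmf.prob Q A = measure_pmf.prob Q (samples n t \<inter> A)"
    using assms by (intro measure_pmf.finite_measure_eq_AE) (auto simp: AE_measure_pmf_iff)
  also have "\<dots> = (\<Sum>X\<in>samples n t \<inter> A. pmf Q X)"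
    using finite_samples by (intro measure_measure_pmf_finite) auto
  finally show ?thesis .
qed

text \<open>
  Sampling from the mixture is the same as drawing the success probabilities independently from
  \<open>\<pi>\<close> and then the observations given these.
\<close>

lemma prob_binmix_prod_eq_integral:
  assumes \<pi>: "\<pi> \<in> mixing_dists"
  shows "integrable (Pi\<^sub>M {..<n} (\<lambda>_. \<pi>)) (\<lambda>\<omega>. measure_pmf.prob (bin_prod n t \<omega>) A)"
    and "measure_pmf.prob (binmix_prod n t \<pi>) A
      = (\<integral>\<omega>. measure_pmf.prob (bin_prod n t \<omega>) A \<partial>Pi\<^sub>M {..<n} (\<lambda>_. \<pi>))"
proof -
  interpret P: prob_space \<pi> using \<pi> by (rule mixing_distsD)
  interpret PS: product_prob_space "\<lambda>_::nat. \<pi>" "{..<n}"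
    by (intro product_prob_spaceI mixing_distsD(1)[OF \<pi>])
  let ?b = "\<lambda>j p. real (t choose j) * p ^ j * (1 - p) ^ (t - j) :: real"
  let ?G = "\<lambda>\<omega>. \<Sum>X\<in>samples n t \<inter> A. \<Prod>i<n. ?b (X i) (\<omega> i)"
  have bi: "integrable \<pi> (?b j)" for j
  proof (rule mixing_dists_integrable[OF \<pi>, where B = "real (t choose j)"])
    fix p :: real assume p: "p \<in> {0..1}"
    then have "p ^ j * (1 - p) ^ (t - j) \<le> 1"
      by (intro mult_le_one power_le_one zero_le_power) auto
    moreover have "0 \<le> p ^ j * (1 - p) ^ (t - j)" using p by auto
    ultimately show "\<bar>?b j p\<bar> \<le> real (t choose j)"
      by (simp add: abs_mult mult.assoc mult_left_le)
  qed measurable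
  have iX: "integrable (Pi\<^sub>M {..<n} (\<lambda>_. \<pi>)) (\<lambda>\<omega>. \<Prod>i<n. ?b (X i) (\<omega> i))" for X
    by (rule PS.product_integrable_prod) (auto intro: bi)
  have G: "measure_pmf.prob (bin_prod n t \<omega>) A = ?G \<omega>" if "\<omega> \<in> space (Pi\<^sub>M {..<n} (\<lambda>_. \<pi>))" for \<omega>
  proof -
    have r: "\<omega> i \<in> {0..1}" if "i < n" for i
      using \<open>\<omega> \<in> _\<close> that mixing_distsD(3)[OF \<pi>] by (auto simp: space_PiM PiE_def Pi_def)
    have "measure_pmf.prob (bin_prod n t \<omega>) A = (\<Sum>X\<in>samples n t \<inter> A. pmf (bin_prod n t \<omega>) X)"
      by (rule prob_eq_sum_samples[OF set_pmf_bin_prod[OF r]])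
    also have "\<dots> = ?G \<omega>"
    proof (rule sum.cong)
      fix X assume "X \<in> samples n t \<inter> A"
      then have "pmf (bin_prod n t \<omega>) X = (\<Prod>i<n. pmf (binomial_pmf t (\<omega> i)) (X i))"
        unfolding bin_prod_def by (intro pmf_Pi') (auto simp: samples_def PiE_dflt_def)
      also have "\<dots> = (\<Prod>i<n. ?b (X i) (\<omega> i))"
        using r by (intro prod.cong) auto
      finally show "pmf (bin_prod n t \<omega>) X = (\<Prod>i<n. ?b (X i) (\<omega> i))" .
    qed simp
    finally show ?thesis .
  qed
  have iG: "integrable (Pi\<^sub>M {..<n} (\<lambda>_. \<pi>)) ?G"
    by (intro Bochner_Integration.integrable_sum iX)
  then show "integrable (Pi\<^sub>M {..<n} (\<lambda>_. \<pi>)) (\<lambda>\<omega>. measure_pmf.prob (bin_prod n t \<omega>) A)"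
    using Bochner_Integration.integrable_cong[OF refl G, of "Pi\<^sub>M {..<n} (\<lambda>_. \<pi>)" "\<lambda>\<omega>. \<omega>"] by simp
  have "measure_pmf.prob (binmix_prod n t \<pi>) A = (\<Sum>X\<in>samples n t \<inter> A. pmf (binmix_prod n t \<pi>) X)"
    by (rule prob_eq_sum_samples[OF set_pmf_binmix_prod[OF \<pi>]])
  also have "\<dots> = (\<Sum>X\<in>samples n t \<inter> A. \<integral>\<omega>. (\<Prod>i<n. ?b (X i) (\<omega> i)) \<partial>Pi\<^sub>M {..<n} (\<lambda>_. \<pi>))"
  proof (rule sum.cong)
    fix X assume "X \<in> samples n t \<inter> A"
    then have "pmf (binmix_prod n t \<pi>) X = (\<Prod>i<n. pmf (binmix t \<pi>) (X i))"
      unfolding binmix_prod_def by (intro pmf_Pi') (auto simp: samples_def PiE_dflt_def)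
    also have "\<dots> = (\<Prod>i<n. \<integral>p. ?b (X i) p \<partial>\<pi>)" by (simp only: pmf_binmix[OF \<pi>])
    also have "\<dots> = (\<integral>\<omega>. (\<Prod>i<n. ?b (X i) (\<omega> i)) \<partial>Pi\<^sub>M {..<n} (\<lambda>_. \<pi>))"
      by (rule PS.product_integral_prod[symmetric]) (auto intro: bi)
    finally show "pmf (binmix_prod n t \<pi>) X = (\<integral>\<omega>. (\<Prod>i<n. ?b (X i) (\<omega> i)) \<partial>Pi\<^sub>M {..<n} (\<lambda>_. \<pi>))" .
  qed simp
  also have "\<dots> = (\<integral>\<omega>. ?G \<omega> \<partial>Pi\<^sub>M {..<n} (\<lambda>_. \<pi>))"
    by (rule Bochner_Integration.integral_sum[symmetric]) (rule iX)
  also have "\<dots> = (\<integral>\<omega>. measure_pmf.prob (bin_prod n t \<omega>) A \<partial>Pi\<^sub>M {..<n} (\<lambda>_. \<pi>))"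
    by (rule Bochner_Integration.integral_cong) (auto simp: G)
  finally show "measure_pmf.prob (binmix_prod n t \<pi>) A
      = (\<integral>\<omega>. measure_pmf.prob (bin_prod n t \<omega>) A \<partial>Pi\<^sub>M {..<n} (\<lambda>_. \<pi>))" .
qed

lemma indep_vars_PiM_coordinates:
  assumes M: "\<And>i. i \<in> I \<Longrightarrow> prob_space (M i)"
  shows "prob_space.indep_vars (Pi\<^sub>M I M) M (\<lambda>i \<omega>. \<omega> i) I"
proof -
  interpret prob_space "Pi\<^sub>M I M" by (rule prob_space_PiM) (rule M)
  show ?thesis
  proof (cases "I = {}")
    case True
    then show ?thesis unfolding indep_vars_def indep_sets_def by simp
  next
    case False
    have "distr (Pi\<^sub>M I M) (Pi\<^sub>M I M) (\<lambda>\<omega>. \<lambda>i\<in>I. \<omega> i) = distr (Pi\<^sub>M I M) (Pi\<^sub>M I M) (\<lambda>\<omega>. \<omega>)"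
      by (rule distr_cong) (auto simp: space_PiM PiE_def extensional_def restrict_def)
    also have "\<dots> = Pi\<^sub>M I M" by simp
    also have "\<dots> = (\<Pi>\<^sub>M i\<in>I. distr (Pi\<^sub>M I M) (M i) (\<lambda>\<omega>. \<omega> i))"
      by (rule PiM_cong[OF refl], rule distr_PiM_component[OF M, symmetric])
    finally show ?thesis
      by (subst indep_vars_iff_distr_eq_PiM'[OF False]) auto
  qed
qed

text \<open>
  The realised mean distance to \<open>p0\<close> is at least half of its expectation \<open>W\<close>, up to probability
  \<open>4 / (n W)\<close>. No bound on the distances other than \<open>1\<close> is used: since
  \<open>\<bar>p - p0\<bar>\<^sup>2 \<le> \<bar>p - p0\<bar>\<close>, the variance of the mean is at most \<open>W / n\<close>.
\<close>

lemma empirical_mean_deviation: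
  assumes \<pi>: "\<pi> \<in> mixing_dists" and p0: "p0 \<in> {0..1}" and n: "n \<ge> 1"
  defines "W \<equiv> \<integral>p. \<bar>p - p0\<bar> \<partial>\<pi>"
  assumes W: "W > 0"
  shows "measure (Pi\<^sub>M {..<n} (\<lambda>_. \<pi>))
      {\<omega> \<in> space (Pi\<^sub>M {..<n} (\<lambda>_. \<pi>)). (1 / real n) * (\<Sum>i<n. \<bar>\<omega> i - p0\<bar>) \<le> W / 2} \<le> 4 / (real n * W)"
    and "{\<omega> \<in> space (Pi\<^sub>M {..<n} (\<lambda>_. \<pi>)). (1 / real n) * (\<Sum>i<n. \<bar>\<omega> i - p0\<bar>) \<le> W / 2}
      \<in> sets (Pi\<^sub>M {..<n} (\<lambda>_. \<pi>))"
proof -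
  let ?M = "Pi\<^sub>M {..<n} (\<lambda>_::nat. \<pi>)"
  interpret P: prob_space \<pi> using \<pi> by (rule mixing_distsD)
  interpret M: prob_space ?M by (rule prob_space_PiM) (rule P.prob_space_axioms)
  have fm: "(\<lambda>p. \<bar>p - p0\<bar>) \<in> borel_measurable \<pi>"
    by (rule mixing_dists_measurable[OF \<pi>]) measurable
  have Ym: "(\<lambda>\<omega>. \<bar>\<omega> i - p0\<bar>) \<in> borel_measurable ?M" if "i < n" for i
    by (rule measurable_compose[OF measurable_component_singleton[of i "{..<n}" "\<lambda>_. \<pi>"] fm]) (use that in simp)
  have Sm: "(\<lambda>\<omega>. (1 / real n) * (\<Sum>i<n. \<bar>\<omega> i - p0\<bar>)) \<in> borel_measurable ?M"
    using Ym by (intro borel_measurable_times borel_measurable_sum) auto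
  show meas: "{\<omega> \<in> space ?M. (1 / real n) * (\<Sum>i<n. \<bar>\<omega> i - p0\<bar>) \<le> W / 2} \<in> sets ?M"
    using Sm by measurable
  have rng: "\<bar>p - p0\<bar> \<le> 1" if "p \<in> {0..1}" for p using that p0 by auto
  have trans: "M.expectation (\<lambda>\<omega>. g (\<omega> i)) = (\<integral>p. g p \<partial>\<pi>)"
    if "i < n" "g \<in> borel_measurable \<pi>" for i and g :: "real \<Rightarrow> real"
  proof -
    have "\<pi> = distr ?M \<pi> (\<lambda>\<omega>. \<omega> i)"
      using that distr_PiM_component[of "{..<n}" "\<lambda>_. \<pi>" i] P.prob_space_axioms by simp
    then have "(\<integral>p. g p \<partial>\<pi>) = (\<integral>p. g p \<partial>distr ?M \<pi> (\<lambda>\<omega>. \<omega> i))" by simp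
    also have "\<dots> = M.expectation (\<lambda>\<omega>. g (\<omega> i))"
      using that by (intro integral_distr) auto
    finally show ?thesis by simp
  qed
  have var: "M.expectation (\<lambda>\<omega>. (\<bar>\<omega> i - p0\<bar> - W)\<^sup>2) \<le> W" if "i < n" for i
  proof -
    have "M.expectation (\<lambda>\<omega>. (\<bar>\<omega> i - p0\<bar> - W)\<^sup>2) = (\<integral>p. (\<bar>p - p0\<bar> - W)\<^sup>2 \<partial>\<pi>)"
      using fm by (intro trans[OF that]) auto
    also have "\<dots> \<le> (\<integral>p. \<bar>p - p0\<bar> - 2 * W * \<bar>p - p0\<bar> + W\<^sup>2 \<partial>\<pi>)"
    proof (rule integral_mono)
      have i1: "integrable \<pi> (\<lambda>p. \<bar>p - p0\<bar>)"
        by (rule mixing_dists_integrable[OF \<pi>, of _ 1]) (use rng in auto)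
      show "integrable \<pi> (\<lambda>p. \<bar>p - p0\<bar> - 2 * W * \<bar>p - p0\<bar> + W\<^sup>2)"
        using i1 by simp
      have "integrable \<pi> (\<lambda>p. (\<bar>p - p0\<bar>)\<^sup>2)"
        by (rule mixing_dists_integrable[OF \<pi>, of _ 1]) (use rng in \<open>auto simp: power_le_one abs_square_le_1\<close>)
      then have "integrable \<pi> (\<lambda>p. (\<bar>p - p0\<bar>)\<^sup>2 - 2 * W * \<bar>p - p0\<bar> + W\<^sup>2)"
        using i1 by (intro Bochner_Integration.integrable_add Bochner_Integration.integrable_diff) auto
      then show "integrable \<pi> (\<lambda>p. (\<bar>p - p0\<bar> - W)\<^sup>2)"
        by (simp add: power2_diff mult_ac diff_add_eq)
      fix p assume "p \<in> space \<pi>"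
      then have "\<bar>p - p0\<bar> \<le> 1" using rng mixing_distsD(3)[OF \<pi>] by auto
      then have sq: "\<bar>p - p0\<bar> * \<bar>p - p0\<bar> \<le> \<bar>p - p0\<bar> * 1" by (intro mult_left_mono) auto
      have gen: "(x - W)\<^sup>2 \<le> x - 2 * W * x + W\<^sup>2" if "x * x \<le> x * 1" for x :: real
        using that by (simp add: power2_eq_square algebra_simps)
      show "(\<bar>p - p0\<bar> - W)\<^sup>2 \<le> \<bar>p - p0\<bar> - 2 * W * \<bar>p - p0\<bar> + W\<^sup>2"
        by (rule gen[OF sq])
    qed
    also have "\<dots> = W - 2 * W * W + W\<^sup>2"
    proof -
      have i1: "integrable \<pi> (\<lambda>p. \<bar>p - p0\<bar>)"
        by (rule mixing_dists_integrable[OF \<pi>, of _ 1]) (use rng in auto)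
      show ?thesis using i1 by (simp add: W_def P.prob_space)
    qed
    also have "\<dots> \<le> W" by (simp add: power2_eq_square)
    finally show ?thesis .
  qed
  have "M.prob {\<omega> \<in> space ?M. (1 / real n) * (\<Sum>i<n. \<bar>\<omega> i - p0\<bar>) \<le> W / 2}
      \<le> M.prob {\<omega> \<in> space ?M. \<bar>(1 / real n) * (\<Sum>i<n. \<bar>\<omega> i - p0\<bar>) - (1 / real n) * (\<Sum>i<n. W)\<bar> \<ge> W / 2}"
  proof (rule M.finite_measure_mono)
    show "{\<omega> \<in> space ?M. \<bar>(1 / real n) * (\<Sum>i<n. \<bar>\<omega> i - p0\<bar>) - (1 / real n) * (\<Sum>i<n. W)\<bar> \<ge> W / 2} \<in> M.events"
      using Sm by measurable
    have e: "(1 / real n) * (\<Sum>i<n. W) = W" using n by simp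
    show "{\<omega> \<in> space ?M. (1 / real n) * (\<Sum>i<n. \<bar>\<omega> i - p0\<bar>) \<le> W / 2}
      \<subseteq> {\<omega> \<in> space ?M. \<bar>(1 / real n) * (\<Sum>i<n. \<bar>\<omega> i - p0\<bar>) - (1 / real n) * (\<Sum>i<n. W)\<bar> \<ge> W / 2}"
    proof -
      have "W / 2 \<le> \<bar>s - W\<bar>" if "s \<le> W / 2" for s using that by linarith
      then show ?thesis unfolding e by blast
    qed
  qed
  also have "\<dots> \<le> (\<Sum>i<n. M.expectation (\<lambda>\<omega>. (\<bar>\<omega> i - p0\<bar> - W)\<^sup>2)) / (real n)\<^sup>2 / (W / 2)\<^sup>2"
  proof (rule M.Chebyshev_average_indep[where B = 1])
    show "M.indep_vars (\<lambda>_. borel) (\<lambda>i \<omega>. \<bar>\<omega> i - p0\<bar>) {..<n}"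
      by (rule M.indep_vars_compose2[OF indep_vars_PiM_coordinates])
         (use fm P.prob_space_axioms in auto)
    fix i assume i: "i < n"
    show "AE \<omega> in ?M. \<bar>\<bar>\<omega> i - p0\<bar>\<bar> \<le> 1"
      using i rng mixing_distsD(3)[OF \<pi>] by (intro AE_I2) (auto simp: space_PiM PiE_def Pi_def)
    show "M.expectation (\<lambda>\<omega>. \<bar>\<omega> i - p0\<bar>) = W"
      unfolding W_def by (rule trans[OF i fm])
  qed (use n W in auto)
  also have "\<dots> \<le> (\<Sum>i<n. W) / (real n)\<^sup>2 / (W / 2)\<^sup>2"
    by (intro divide_right_mono sum_mono var) auto
  also have "\<dots> = 4 / (real n * W)"
    using n W by (simp add: power2_eq_square field_simps)
  finally show "M.prob {\<omega> \<in> space ?M. (1 / real n) * (\<Sum>i<n. \<bar>\<omega> i - p0\<bar>) \<le> W / 2} \<le> 4 / (real n * W)" .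
qed

text \<open>
  Reduction of a bound under the mixture to a bound that holds for every sequence of success
  probabilities which is far enough from \<open>p0\<close> on average.
\<close>

lemma prob_binmix_prod_le:
  assumes \<pi>: "\<pi> \<in> mixing_dists" and p0: "p0 \<in> {0..1}" and n: "n \<ge> 1"
  defines "W \<equiv> \<integral>p. \<bar>p - p0\<bar> \<partial>\<pi>"
  assumes W: "W > 0" and b: "b \<ge> 0"
    and bound: "\<And>p. (\<And>i. i < n \<Longrightarrow> p i \<in> {0..1}) \<Longrightarrow> (1 / real n) * (\<Sum>i<n. \<bar>p i - p0\<bar>) > W / 2 \<Longrightarrow>
      measure_pmf.prob (bin_prod n t p) A \<le> b"
  shows "measure_pmf.prob (binmix_prod n t \<pi>) A \<le> b + 4 / (real n * W)"
proof -
  let ?M = "Pi\<^sub>M {..<n} (\<lambda>_::nat. \<pi>)"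
  let ?E = "{\<omega> \<in> space ?M. (1 / real n) * (\<Sum>i<n. \<bar>\<omega> i - p0\<bar>) \<le> W / 2}"
  interpret P: prob_space \<pi> using \<pi> by (rule mixing_distsD)
  interpret M: prob_space ?M by (rule prob_space_PiM) (rule P.prob_space_axioms)
  note dev = empirical_mean_deviation[OF \<pi> p0 n W[unfolded W_def], folded W_def]
  have "measure_pmf.prob (binmix_prod n t \<pi>) A = M.expectation (\<lambda>\<omega>. measure_pmf.prob (bin_prod n t \<omega>) A)"
    by (rule prob_binmix_prod_eq_integral[OF \<pi>])
  also have "\<dots> \<le> M.expectation (\<lambda>\<omega>. b + indicator ?E \<omega>)"
  proof (rule integral_mono)
    show "integrable ?M (\<lambda>\<omega>. measure_pmf.prob (bin_prod n t \<omega>) A)"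
      by (rule prob_binmix_prod_eq_integral[OF \<pi>])
    show "integrable ?M (\<lambda>\<omega>. b + indicator ?E \<omega>)"
      using dev(2) by (intro Bochner_Integration.integrable_add integrable_real_indicator) (auto simp: M.emeasure_eq_measure)
    fix \<omega> assume w: "\<omega> \<in> space ?M"
    show "measure_pmf.prob (bin_prod n t \<omega>) A \<le> b + indicator ?E \<omega>"
    proof (cases "\<omega> \<in> ?E")
      case True
      then have "(indicator ?E \<omega> :: real) = 1" by (rule indicator_simps(1))
      then show ?thesis using b measure_pmf.prob_le_1[of "bin_prod n t \<omega>" A] by linarith
    next
      case False
      have "\<omega> i \<in> {0..1}" if "i < n" for i
        using w that mixing_distsD(3)[OF \<pi>] by (auto simp: space_PiM PiE_def Pi_def)
      then show ?thesis using False w bound[of \<omega>] by auto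
    qed
  qed
  also have "\<dots> = b + M.prob ?E"
    using dev(2) by (subst Bochner_Integration.integral_add) (auto simp: M.prob_space M.emeasure_eq_measure)
  finally show ?thesis using dev(1) by simp
qed

lemma binomial_pmf_reflect:
  assumes "p \<in> {0..1}"
  shows "map_pmf (\<lambda>x. t - x) (binomial_pmf t p) = binomial_pmf t (1 - p)"
proof (rule pmf_eqI)
  fix j
  show "pmf (map_pmf (\<lambda>x. t - x) (binomial_pmf t p)) j = pmf (binomial_pmf t (1 - p)) j"
  proof (cases "j \<le> t")
    case True
    have "pmf (map_pmf (\<lambda>x. t - x) (binomial_pmf t p)) j = measure_pmf.prob (binomial_pmf t p) ((\<lambda>x. t - x) -` {j})"
      by (rule pmf_map)
    also have "\<dots> = measure_pmf.prob (binomial_pmf t p) {t - j}"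
      using set_pmf_binomial_subset[OF assms, of t] True
      by (intro measure_pmf.finite_measure_eq_AE) (auto simp: AE_measure_pmf_iff)
    also have "\<dots> = pmf (binomial_pmf t p) (t - j)" by (simp add: measure_pmf_single)
    also have "\<dots> = pmf (binomial_pmf t (1 - p)) j"
      using True assms by (simp add: binomial_symmetric[of j t])
    finally show ?thesis .
  next
    case False
    then have "j \<notin> set_pmf (map_pmf (\<lambda>x. t - x) (binomial_pmf t p))" by auto
    moreover have "pmf (binomial_pmf t (1 - p)) j = 0" using False assms by simp
    ultimately show ?thesis by (simp add: set_pmf_eq)
  qed
qed

text \<open>
  The event may depend on the first \<open>n\<close> coordinates only, because the reflected sample takes the
  value \<open>t\<close> instead of the default value \<open>0\<close> outside of them.
\<close>

lemma prob_bin_prod_reflect: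
  assumes p: "\<And>i. i < n \<Longrightarrow> p i \<in> {0..1}"
    and coords: "\<And>X Y. (\<And>i. i < n \<Longrightarrow> X i = Y i) \<Longrightarrow> Q X = Q Y"
  shows "measure_pmf.prob (bin_prod n t p) {X. Q (\<lambda>i. t - X i)}
       = measure_pmf.prob (bin_prod n t (\<lambda>i. 1 - p i)) {X. Q X}"
proof -
  have "bin_prod n t (\<lambda>i. 1 - p i) = Pi_pmf {..<n} 0 (\<lambda>i. map_pmf (\<lambda>x. t - x) (binomial_pmf t (p i)))"
    unfolding bin_prod_def by (rule Pi_pmf_cong) (auto simp: binomial_pmf_reflect[OF p])
  also have "\<dots> = map_pmf (\<lambda>f x. if x \<in> {..<n} then f x else 0)
      (Pi_pmf {..<n} t (\<lambda>i. map_pmf (\<lambda>x. t - x) (binomial_pmf t (p i))))"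
    by (rule Pi_pmf_default_swap[symmetric]) simp
  also have "Pi_pmf {..<n} t (\<lambda>i. map_pmf (\<lambda>x. t - x) (binomial_pmf t (p i)))
      = map_pmf (\<lambda>h. (\<lambda>x. t - x) \<circ> h) (bin_prod n t p)"
    unfolding bin_prod_def by (rule Pi_pmf_map) auto
  finally have eq: "bin_prod n t (\<lambda>i. 1 - p i) = map_pmf (\<lambda>X i. if i < n then t - X i else 0) (bin_prod n t p)"
    by (simp add: pmf.map_comp o_def)
  have "Q (\<lambda>i. if i < n then t - X i else 0) = Q (\<lambda>i. t - X i)" for X
    by (rule coords) simp
  then show ?thesis by (simp add: eq vimage_def)
qed

section \<open>Level of the test\<close>

lemma prob_greater_upper_quantile:
  assumes fin: "finite (set_pmf P)" and a: "a \<ge> 0"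
  shows "measure_pmf.prob P {X. T X > upper_quantile a P T} \<le> a"
proof -
  let ?F = "\<lambda>u. measure_pmf.prob P {X. T X > u}"
  let ?U = "{u. ?F u \<le> a}"
  let ?q = "upper_quantile a P T"
  have "?F (Max (T ` set_pmf P)) = measure_pmf.prob P {}"
    using fin by (intro measure_pmf.finite_measure_eq_AE) (auto simp: AE_measure_pmf_iff not_less)
  then have "Max (T ` set_pmf P) \<in> ?U" using a by simp
  then have ne: "?U \<noteq> {}" by blast
  have le: "?F (?q + 1 / real (Suc k)) \<le> a" for k
  proof -
    have "Inf ?U < ?q + 1 / real (Suc k)" by (simp add: upper_quantile_def)
    then obtain u where u: "u \<in> ?U" "u < ?q + 1 / real (Suc k)"
      using cInf_lessD[OF ne] by blast
    then have "?F (?q + 1 / real (Suc k)) \<le> ?F u"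
      by (intro measure_pmf.finite_measure_mono) auto
    then show ?thesis using u by simp
  qed
  have un: "(\<Union>k. {X. T X > ?q + 1 / real (Suc k)}) = {X. T X > ?q}"
  proof safe
    fix X k assume h: "T X > ?q + 1 / real (Suc k)"
    have "0 < 1 / real (Suc k)" by simp
    with h show "T X > ?q" by linarith
  next
    fix X assume "T X > ?q"
    then have "T X - ?q > 0" by simp
    from reals_Archimedean[OF this] obtain k where "inverse (real (Suc k)) < T X - ?q" by blast
    then show "X \<in> (\<Union>k. {X. T X > ?q + 1 / real (Suc k)})"
      by (auto simp: inverse_eq_divide intro!: exI[of _ k])
  qed
  have "incseq (\<lambda>k. {X. T X > ?q + 1 / real (Suc k)})"
  proof (rule incseq_SucI)
    fix k :: nat
    have "1 / real (Suc (Suc k)) \<le> 1 / real (Suc k)" by (simp add: field_simps)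
    then show "{X. T X > ?q + 1 / real (Suc k)} \<subseteq> {X. T X > ?q + 1 / real (Suc (Suc k))}" by auto
  qed
  then have "(\<lambda>k. ?F (?q + 1 / real (Suc k))) \<longlonglongrightarrow> measure_pmf.prob P (\<Union>k. {X. T X > ?q + 1 / real (Suc k)})"
    by (intro measure_pmf.finite_Lim_measure_incseq) auto
  then have "(\<lambda>k. ?F (?q + 1 / real (Suc k))) \<longlonglongrightarrow> ?F ?q" by (simp only: un)
  then show ?thesis by (rule LIMSEQ_le_const2) (use le in auto)
qed

lemma upper_quantile_le:
  assumes fin: "finite (set_pmf P)" and a: "a < 1"
    and u: "measure_pmf.prob P {X. T X > u} \<le> a"
  shows "upper_quantile a P T \<le> u"
  unfolding upper_quantile_def
proof (rule cInf_lower)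
  show "bdd_below {u. measure_pmf.prob P {X. T X > u} \<le> a}"
  proof (rule bdd_belowI[of _ "Min (T ` set_pmf P)"], rule ccontr)
    fix v assume v: "v \<in> {u. measure_pmf.prob P {X. T X > u} \<le> a}" "\<not> Min (T ` set_pmf P) \<le> v"
    have "v < T X" if "X \<in> set_pmf P" for X
    proof -
      have "Min (T ` set_pmf P) \<le> T X" using fin that by (intro Min_le) auto
      then show ?thesis using v(2) by linarith
    qed
    then have "AE X in P. X \<in> {X. T X > v}"
      by (auto simp: AE_measure_pmf_iff)
    then have "measure_pmf.prob P {X. T X > v} = 1"
      by (subst measure_pmf.prob_eq_1) auto
    with v(1) a show False by simp
  qed
qed (use u in simp)

lemma finite_set_pmf_bin_prod:
  "(\<And>i. i < n \<Longrightarrow> p i \<in> {0..1}) \<Longrightarrow> finite (set_pmf (bin_prod n t p))"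
  using set_pmf_bin_prod finite_samples by (metis finite_subset)

lemma kravchuk_stat_cong:
  "(\<And>i. i < n \<Longrightarrow> X i = Y i) \<Longrightarrow> kravchuk_stat n t m p0 X = kravchuk_stat n t m p0 Y"
  unfolding kravchuk_stat_def by (intro arg_cong2[of _ _ _ _ "(*)"] sum.cong) auto

lemma psi_LM_lower_cong:
  "(\<And>i. i < n \<Longrightarrow> X i = Y i) \<Longrightarrow> psi_LM_lower n t \<alpha> p0 X = psi_LM_lower n t \<alpha> p0 Y"
  using kravchuk_stat_cong[of n X Y t 1 p0] kravchuk_stat_cong[of n X Y t 2 p0]
  by (simp add: psi_LM_lower_def psi_def)

lemma psi_level:
  assumes "p0 \<in> {0..1}" "a \<ge> 0"
  shows "measure_pmf.prob (bin_prod n t (\<lambda>_. p0)) {X. psi n t m a p0 X = 1} \<le> a"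
proof -
  have "finite (set_pmf (bin_prod n t (\<lambda>_. p0)))"
    using assms by (intro finite_set_pmf_bin_prod) auto
  from prob_greater_upper_quantile[OF this assms(2), of "kravchuk_stat n t m p0"]
  show ?thesis by (simp add: psi_def binmix_prod_point_mass[OF assms(1)])
qed

lemma psi_LM_lower_level:
  assumes "p0 \<in> {0..1}" "\<alpha> \<ge> 0"
  shows "measure_pmf.prob (bin_prod n t (\<lambda>_. p0)) {X. psi_LM_lower n t \<alpha> p0 X = 1} \<le> \<alpha>"
proof -
  let ?P = "measure_pmf.prob (bin_prod n t (\<lambda>_. p0))"
  have "{X. psi_LM_lower n t \<alpha> p0 X = 1} = {X. psi n t 1 (\<alpha>/2) p0 X = 1} \<union> {X. psi n t 2 (\<alpha>/2) p0 X = 1}"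
    by (auto simp: psi_LM_lower_def psi_def)
  then have "?P {X. psi_LM_lower n t \<alpha> p0 X = 1} \<le> ?P {X. psi n t 1 (\<alpha>/2) p0 X = 1} + ?P {X. psi n t 2 (\<alpha>/2) p0 X = 1}"
    by (simp add: measure_Un_le)
  also have "\<dots> \<le> \<alpha> / 2 + \<alpha> / 2"
    using assms by (intro add_mono psi_level) auto
  finally show ?thesis by simp
qed

lemma psi_LM_level:
  assumes p0: "p0 \<in> {0..1}" and "\<alpha> \<ge> 0"
  shows "measure_pmf.prob (binmix_prod n t (point_mass p0)) {X. psi_LM n t \<alpha> p0 X = 1} \<le> \<alpha>"
proof (cases "p0 \<le> 1 / 2")
  case True
  then show ?thesis using psi_LM_lower_level[OF assms] by (simp add: psi_LM_def binmix_prod_point_mass[OF p0])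
next
  case False
  have "measure_pmf.prob (bin_prod n t (\<lambda>_. p0)) {X. psi_LM_lower n t \<alpha> (1 - p0) (\<lambda>i. t - X i) = 1}
      = measure_pmf.prob (bin_prod n t (\<lambda>_. 1 - p0)) {X. psi_LM_lower n t \<alpha> (1 - p0) X = 1}"
    using p0 psi_LM_lower_cong
    by (intro prob_bin_prod_reflect[where Q = "\<lambda>X. psi_LM_lower n t \<alpha> (1 - p0) X = 1"]) metis+
  also have "\<dots> \<le> \<alpha>" using assms by (intro psi_LM_lower_level) auto
  finally show ?thesis using False by (simp add: psi_LM_def binmix_prod_point_mass[OF p0])
qed

section \<open>Power of the two statistics\<close>

text \<open>
  Two applications of Chebyshev's inequality: under the null hypothesis it shows that the
  critical value is at most \<open>u\<close>, and under the alternative that the statistic, whose mean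
  is at least \<open>2 u\<close>, exceeds \<open>u\<close>. Here \<open>mm\<close> and \<open>vv\<close> are the mean and the variance of one summand as
  functions of its success probability.
\<close>

lemma psi_type2:
  fixes mm vv :: "real \<Rightarrow> real"
  assumes mean: "\<And>q. q \<in> {0..1} \<Longrightarrow> measure_pmf.expectation (binomial_pmf t q) (\<lambda>x. kravchuk m x p0 t) = mm q"
    and var: "\<And>q. q \<in> {0..1} \<Longrightarrow> measure_pmf.expectation (binomial_pmf t q) (\<lambda>x. (kravchuk m x p0 t - mm q)\<^sup>2) = vv q"
    and p0: "p0 \<in> {0..1}" and mm0: "mm p0 = 0"
    and p: "\<And>i. i < n \<Longrightarrow> p i \<in> {0..1}"
    and n: "n \<ge> 1" and u: "u > 0" and a: "a < 1"
    and null: "vv p0 / (real n * u\<^sup>2) \<le> a"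
    and alt: "(1 / real n) * (\<Sum>i<n. mm (p i)) \<ge> 2 * u"
  shows "measure_pmf.prob (bin_prod n t p) {X. psi n t m a p0 X = 0}
    \<le> (\<Sum>i<n. vv (p i)) / (real n)\<^sup>2 / u\<^sup>2"
proof -
  let ?T = "kravchuk_stat n t m p0"
  let ?P0 = "bin_prod n t (\<lambda>_. p0)"
  have fin: "finite (set_pmf ?P0)" using p0 by (intro finite_set_pmf_bin_prod) auto
  have dev: "u < s \<Longrightarrow> u \<le> \<bar>s - 0\<bar>" for s :: real by linarith
  have "measure_pmf.prob ?P0 {X. ?T X > u}
      \<le> measure_pmf.prob ?P0 {X. \<bar>(1 / real n) * (\<Sum>i<n. kravchuk m (X i) p0 t) - (1 / real n) * (\<Sum>i<n. mm p0)\<bar> \<ge> u}"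
    unfolding mm0 kravchuk_stat_def sum.neutral_const mult_zero_right
    by (intro measure_pmf.finite_measure_mono) (use dev in blast, simp)
  also have "\<dots> \<le> (\<Sum>i<n. measure_pmf.expectation (binomial_pmf t p0) (\<lambda>x. (kravchuk m x p0 t - mm p0)\<^sup>2)) / (real n)\<^sup>2 / u\<^sup>2"
    unfolding bin_prod_def
    by (rule Chebyshev_average_Pi_pmf) (use p0 n u mean[OF p0] in auto)
  also have "\<dots> = vv p0 / (real n * u\<^sup>2)"
    unfolding var[OF p0] using n by (simp add: power2_eq_square[of "real n"])
  also note null
  finally have "upper_quantile a ?P0 ?T \<le> u"
    by (intro upper_quantile_le fin a) auto
  then have "measure_pmf.prob (bin_prod n t p) {X. psi n t m a p0 X = 0}
      \<le> measure_pmf.prob (bin_prod n t p) {X. \<bar>(1 / real n) * (\<Sum>i<n. kravchuk m (X i) p0 t) - (1 / real n) * (\<Sum>i<n. mm (p i))\<bar> \<ge> u}"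
    using alt by (intro measure_pmf.finite_measure_mono)
      (auto simp: psi_def binmix_prod_point_mass[OF p0] kravchuk_stat_def)
  also have "\<dots> \<le> (\<Sum>i<n. measure_pmf.expectation (binomial_pmf t (p i)) (\<lambda>x. (kravchuk m x p0 t - mm (p i))\<^sup>2)) / (real n)\<^sup>2 / u\<^sup>2"
    unfolding bin_prod_def
    by (rule Chebyshev_average_Pi_pmf) (use p n u mean[OF p] in auto)
  also have "\<dots> = (\<Sum>i<n. vv (p i)) / (real n)\<^sup>2 / u\<^sup>2"
    using var[OF p] by simp
  finally show ?thesis .
qed

section \<open>The separation rate\<close>

text \<open>
  The part of the separation rate that depends on \<open>\<mu> = p0 (1 - p0)\<close>. The distance \<open>\<mu>\<close>
  is one that deviations below \<open>p0\<close>, for small \<open>p0\<close>, cannot exceed up to a constant; the other term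
  is the square root of \<open>\<mu> / (t \<surd>n)\<close>, the order of the null standard deviation of the second
  statistic.
\<close>

definition min_rate :: "real \<Rightarrow> nat \<Rightarrow> nat \<Rightarrow> real" where
  "min_rate \<mu> n t = min \<mu> (sqrt \<mu> / (sqrt (real t) * real n powr (1 / 4)))"

text \<open>
  The separation rate for all \<open>t\<close> and \<open>n\<close> at once. For \<open>t\<close> of order at least \<open>\<surd>n\<close> the
  minimum can be dropped, see \<open>rate_le_for_large_t\<close>.
\<close>

definition rate :: "real \<Rightarrow> nat \<Rightarrow> nat \<Rightarrow> real" where
  "rate \<mu> n t = max (1 / real n) (min_rate \<mu> n t)"

lemma square_root_rate:
  assumes "\<mu> \<ge> 0" "n \<ge> 1"
  shows "(sqrt \<mu> / (sqrt (real t) * real n powr (1 / 4)))\<^sup>2 = \<mu> / (real t * sqrt (real n))"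
proof -
  have "(real n powr (1 / 4))\<^sup>2 = real n powr (1 / 4 + 1 / 4)"
    by (simp only: powr_add power2_eq_square)
  also have "\<dots> = sqrt (real n)" by (simp add: powr_half_sqrt)
  finally show ?thesis using assms by (simp add: power_divide power_mult_distrib)
qed

text \<open>
  The null standard deviation of the first statistic never exceeds the rate.
\<close>

lemma rate_noise:
  assumes "\<mu> \<ge> 0" "n \<ge> 1" "t \<ge> 1"
  shows "\<mu> / (real t * real n) \<le> (rate \<mu> n t)\<^sup>2"
proof (cases "\<mu> \<le> sqrt \<mu> / (sqrt (real t) * real n powr (1 / 4))")
  case True
  then have r: "rate \<mu> n t \<ge> \<mu>" "rate \<mu> n t \<ge> 1 / real n" by (auto simp: rate_def min_rate_def)
  have "\<mu> / (real t * real n) \<le> \<mu> * (1 / real n)"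
  proof -
    have "1 / (real t * real n) \<le> 1 / (1 * real n)"
      using assms by (intro divide_left_mono mult_right_mono) auto
    then show ?thesis using mult_left_mono[OF _ assms(1)] by fastforce
  qed
  also have "\<dots> \<le> rate \<mu> n t * rate \<mu> n t"
    using r assms by (intro mult_mono) auto
  finally show ?thesis by (simp add: power2_eq_square)
next
  case False
  then have r: "rate \<mu> n t \<ge> sqrt \<mu> / (sqrt (real t) * real n powr (1 / 4))"
    by (auto simp: rate_def min_rate_def)
  have "\<mu> / (real t * real n) \<le> \<mu> / (real t * sqrt (real n))"
  proof -
    have "sqrt (real n) \<le> real n"
      using assms(2) by (intro real_le_lsqrt) (auto simp: self_le_power)
    then show ?thesis
      using assms by (intro divide_left_mono mult_left_mono) auto
  qed
  also have "\<dots> \<le> (rate \<mu> n t)\<^sup>2"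
    unfolding square_root_rate[OF assms(1,2), symmetric] using r assms by (intro power_mono) auto
  finally show ?thesis .
qed

section \<open>Upper bound on the type II error\<close>

lemma bernoulli_variance_le:
  fixes p p0 :: real
  assumes "p \<in> {0..1}" "p0 \<in> {0..1}"
  shows "p * (1 - p) \<le> p0 * (1 - p0) + \<bar>p - p0\<bar>"
proof -
  have "p * (1 - p) - p0 * (1 - p0) = (p - p0) * (1 - p - p0)" by (simp add: algebra_simps)
  also have "\<dots> \<le> \<bar>p - p0\<bar> * \<bar>1 - p - p0\<bar>" by (simp add: abs_mult[symmetric])
  also have "\<dots> \<le> \<bar>p - p0\<bar> * 1" using assms by (intro mult_left_mono) auto
  finally show ?thesis by simp
qed

lemma sum_cube_le:
  fixes d :: "nat \<Rightarrow> real"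
  shows "(\<Sum>i<n. \<bar>d i\<bar> ^ 3) \<le> sqrt (\<Sum>i<n. (d i)\<^sup>2) * (\<Sum>i<n. (d i)\<^sup>2)"
proof -
  have "(\<Sum>i<n. \<bar>d i\<bar> ^ 3) \<le> (\<Sum>i<n. sqrt (\<Sum>i<n. (d i)\<^sup>2) * (d i)\<^sup>2)"
  proof (rule sum_mono)
    fix i assume "i \<in> {..<n}"
    then have "(d i)\<^sup>2 \<le> (\<Sum>i<n. (d i)\<^sup>2)" by (intro member_le_sum) auto
    then have "\<bar>d i\<bar> \<le> sqrt (\<Sum>i<n. (d i)\<^sup>2)" using real_sqrt_le_mono by fastforce
    then have "\<bar>d i\<bar> * (d i)\<^sup>2 \<le> sqrt (\<Sum>i<n. (d i)\<^sup>2) * (d i)\<^sup>2" by (intro mult_right_mono) auto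
    then show "\<bar>d i\<bar> ^ 3 \<le> sqrt (\<Sum>i<n. (d i)\<^sup>2) * (d i)\<^sup>2"
      by (simp add: power3_eq_cube power2_eq_square mult.assoc)
  qed
  then show ?thesis by (simp add: sum_distrib_left)
qed

text \<open>
  If the signed mean deviation is at least half of the mean absolute deviation \<open>S\<close>, the linear statistic
  detects the alternative. The threshold is \<open>u = S / 4\<close>.
\<close>

lemma psi_1_type2:
  fixes p :: "nat \<Rightarrow> real"
  assumes p: "\<And>i. i < n \<Longrightarrow> p i \<in> {0..1}" and p0: "p0 \<in> {0..1}"
    and n: "n \<ge> 1" and t: "t \<ge> 1" and C: "C \<ge> 1" and a: "16 / C \<le> a" "a < 1"
  defines "\<mu> \<equiv> p0 * (1 - p0)" and "S \<equiv> (1 / real n) * (\<Sum>i<n. \<bar>p i - p0\<bar>)"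
  assumes S: "S \<ge> C * rate \<mu> n t"
    and D: "(1 / real n) * (\<Sum>i<n. p i - p0) \<ge> S / 2"
  shows "measure_pmf.prob (bin_prod n t p) {X. psi n t 1 a p0 X = 0} \<le> 32 / C"
proof -
  have \<mu>: "\<mu> \<ge> 0" using p0 by (simp add: \<mu>_def)
  have r: "rate \<mu> n t \<ge> 1 / real n" by (simp add: rate_def)
  have "1 / real n > 0" using n by simp
  with r have rpos: "rate \<mu> n t > 0" by linarith
  have "C * rate \<mu> n t > 0" using C rpos by simp
  with S have Spos: "S > 0" by linarith
  have r_le: "rate \<mu> n t \<le> S / C" using S C by (simp add: field_simps)
  have noise: "\<mu> / (real t * real n) \<le> S\<^sup>2 / C"
  proof -
    have "\<mu> / (real t * real n) \<le> (rate \<mu> n t)\<^sup>2" by (rule rate_noise[OF \<mu> n t])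
    also have "\<dots> \<le> (S / C)\<^sup>2" using r_le rpos by (intro power_mono) auto
    also have "\<dots> = S\<^sup>2 / (C * C)" by (simp add: power_divide power2_eq_square)
    also have "\<dots> \<le> S\<^sup>2 / (1 * C)" using C by (intro divide_left_mono mult_right_mono) auto
    finally show ?thesis by simp
  qed
  have noise2: "S / (real t * real n) \<le> S\<^sup>2 / C"
  proof -
    have "1 / (real t * real n) \<le> 1 / (1 * real n)"
      using n t by (intro divide_left_mono mult_right_mono) auto
    also have "\<dots> \<le> S / C" using r r_le by simp
    finally have "S * (1 / (real t * real n)) \<le> S * (S / C)" using Spos by (intro mult_left_mono) auto
    then show ?thesis by (simp add: power2_eq_square)
  qed
  have "measure_pmf.prob (bin_prod n t p) {X. psi n t 1 a p0 X = 0}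
      \<le> (\<Sum>i<n. p i * (1 - p i) / real t) / (real n)\<^sup>2 / (S / 4)\<^sup>2"
  proof (rule psi_type2[where mm = "\<lambda>q. q - p0" and vv = "\<lambda>q. q * (1 - q) / real t"])
    show "p0 * (1 - p0) / real t / (real n * (S / 4)\<^sup>2) \<le> a"
    proof -
      have "p0 * (1 - p0) / real t / (real n * (S / 4)\<^sup>2) = (\<mu> / (real t * real n)) * 16 / S\<^sup>2"
        by (simp add: \<mu>_def power_divide)
      also have "\<dots> \<le> (S\<^sup>2 / C) * 16 / S\<^sup>2"
        using noise by (intro divide_right_mono mult_right_mono) auto
      also have "\<dots> = 16 / C" using Spos by simp
      finally show ?thesis using a by simp
    qed
  qed (use p p0 n t a D Spos kravchuk_1_moments in auto)
  also have "\<dots> \<le> (real n * (\<mu> + S) / real t) / (real n)\<^sup>2 / (S / 4)\<^sup>2"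
  proof (intro divide_right_mono)
    have "(\<Sum>i<n. p i * (1 - p i) / real t) \<le> (\<Sum>i<n. (\<mu> + \<bar>p i - p0\<bar>) / real t)"
      unfolding \<mu>_def using bernoulli_variance_le p p0 by (intro sum_mono divide_right_mono) auto
    also have "\<dots> = real n * (\<mu> + S) / real t"
      using n by (simp add: S_def sum.distrib sum_divide_distrib[symmetric] algebra_simps)
    finally show "(\<Sum>i<n. p i * (1 - p i) / real t) \<le> real n * (\<mu> + S) / real t" .
  qed auto
  also have "\<dots> = (\<mu> / (real t * real n) + S / (real t * real n)) * 16 / S\<^sup>2"
    using n t Spos by (simp add: power2_eq_square) (simp add: field_simps)
  also have "\<dots> \<le> (S\<^sup>2 / C + S\<^sup>2 / C) * 16 / S\<^sup>2"
    using noise noise2 by (intro divide_right_mono mult_right_mono add_mono) auto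
  also have "\<dots> = 32 / C" using Spos by (simp add: field_simps)
  finally show ?thesis .
qed

text \<open>
  The left-hand side is the bound on the variance of the quadratic statistic, whose mean is \<open>g\<^sup>2\<close>; for
  large \<open>A\<close> it is a small fraction of the square of that mean. In the application \<open>s = \<surd>n\<close>, \<open>x = 1 / (t s)\<close> and \<open>A\<close> is the square of the separation constant.
\<close>

lemma quadratic_variance_algebra:
  fixes \<mu> g x s A :: real
  assumes \<mu>: "\<mu> \<ge> 0" and g: "g > 0" and x: "x \<ge> 0" and s: "s \<ge> 1" and A: "A \<ge> 1"
    and i: "\<mu> * x \<le> g\<^sup>2 / A" and ii: "x \<le> 8 * g / A"
  shows "8 * (\<mu> * x)\<^sup>2 + 8 * g\<^sup>2 * x\<^sup>2 + 4 * (\<mu> * x) * g\<^sup>2 / s + 4 * g ^ 3 * x \<le> 556 * g ^ 4 / A"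
proof -
  have AA: "1 / A\<^sup>2 \<le> 1 / A"
    using A by (intro divide_left_mono) (auto simp: power2_eq_square)
  have "(\<mu> * x)\<^sup>2 \<le> (g\<^sup>2 / A)\<^sup>2" using i \<mu> x by (intro power_mono) auto
  also have "\<dots> = g ^ 4 * (1 / A\<^sup>2)" by (simp add: power_divide flip: power_mult)
  also have "\<dots> \<le> g ^ 4 * (1 / A)" by (intro mult_left_mono AA) auto
  finally have 1: "(\<mu> * x)\<^sup>2 \<le> g ^ 4 / A" by simp
  have "x\<^sup>2 \<le> (8 * g / A)\<^sup>2" using ii x by (intro power_mono) auto
  then have "g\<^sup>2 * x\<^sup>2 \<le> g\<^sup>2 * (8 * g / A)\<^sup>2" by (intro mult_left_mono) auto
  also have "\<dots> = 64 * g ^ 4 * (1 / A\<^sup>2)" by (simp add: power_divide power_mult_distrib flip: power_add)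
  also have "\<dots> \<le> 64 * g ^ 4 * (1 / A)" by (intro mult_left_mono AA) auto
  finally have 2: "g\<^sup>2 * x\<^sup>2 \<le> 64 * g ^ 4 / A" by simp
  have "(\<mu> * x) * g\<^sup>2 / s \<le> (\<mu> * x) * g\<^sup>2 / 1"
    using s \<mu> x by (intro divide_left_mono) auto
  also have "\<dots> \<le> (g\<^sup>2 / A) * g\<^sup>2 / 1" using i by (intro divide_right_mono mult_right_mono) auto
  also have "\<dots> = g ^ 4 / A" by (simp flip: power_add)
  finally have 3: "(\<mu> * x) * g\<^sup>2 / s \<le> g ^ 4 / A" .
  have "g ^ 3 * x \<le> g ^ 3 * (8 * g / A)" using ii g by (intro mult_left_mono) auto
  also have "\<dots> = 8 * g ^ 4 / A" by (simp add: eval_nat_numeral)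
  finally have 4: "g ^ 3 * x \<le> 8 * g ^ 4 / A" .
  from 1 2 3 4 show ?thesis by (simp add: mult.assoc)
qed

text \<open>
  If the signed mean deviation is less than half of the mean absolute deviation \<open>S\<close>, the quadratic statistic
  detects the alternative, with threshold \<open>u = M / 2\<close> for \<open>M\<close> the mean of \<open>(p i - p0)\<^sup>2\<close>. The
  assumption forces \<open>S < 8 \<mu>\<close>, so the rate is below \<open>\<mu>\<close> and \<open>S\<^sup>2\<close> exceeds a
  large multiple of \<open>\<mu> / (t \<surd>n)\<close>; as \<open>\<mu> > S / 8\<close>, also \<open>S\<close> itself exceeds a large multiple of
  \<open>1 / (t \<surd>n)\<close>. These are the inequalities \<open>i\<close> and \<open>ii\<close> that control the variance.
\<close>

lemma psi_2_type2:
  fixes p :: "nat \<Rightarrow> real"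
  assumes p: "\<And>i. i < n \<Longrightarrow> p i \<in> {0..1}" and p0: "p0 \<in> {0..1}" "p0 \<le> 1 / 2"
    and n: "n \<ge> 1" and t: "t \<ge> 2" and C: "C \<ge> 8" and a: "16 / C \<le> a" "a < 1"
  defines "\<mu> \<equiv> p0 * (1 - p0)" and "S \<equiv> (1 / real n) * (\<Sum>i<n. \<bar>p i - p0\<bar>)"
  assumes S: "S \<ge> C * rate \<mu> n t"
    and D: "(1 / real n) * (\<Sum>i<n. p i - p0) < S / 2"
  shows "measure_pmf.prob (bin_prod n t p) {X. psi n t 2 a p0 X = 0} \<le> 2224 / C"
proof -
  define T where "T = real t"
  define s where "s = sqrt (real n)"
  define x where "x = 1 / (T * s)"
  define M where "M = (1 / real n) * (\<Sum>i<n. (p i - p0)\<^sup>2)"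
  define g where "g = sqrt M"
  define A where "A = C\<^sup>2"
  define d where "d = (\<lambda>i. p i - p0)"
  have T: "T \<ge> 2" using t by (simp add: T_def)
  have s: "s \<ge> 1" "s * s = real n" using n by (auto simp: s_def)
  have npos: "real n > 0" using n by simp
  have xpos: "x > 0" using T s by (simp add: x_def)
  have A: "A \<ge> 1" "C \<le> A" using C mult_mono[of 1 C 1 C] by (auto simp: A_def power2_eq_square)
  have \<mu>: "\<mu> \<ge> 0" using p0 by (simp add: \<mu>_def)
  have p0\<mu>: "p0 \<le> 2 * \<mu>"
    using mult_left_mono[of "1/2" "1 - p0" p0] p0 by (simp add: \<mu>_def)
  have r: "rate \<mu> n t \<ge> 1 / real n" by (simp add: rate_def)
  have "1 / real n > 0" using n by simp
  with r have rpos: "rate \<mu> n t > 0" by linarith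
  have "C * rate \<mu> n t > 0" using C rpos by simp
  with S have Spos: "S > 0" by linarith
  \<comment> \<open>the signed mean being small, the negative parts, which are at most \<open>p0\<close>, carry the deviation\<close>
  have S_lt: "S < 8 * \<mu>"
  proof -
    have "(\<Sum>i<n. \<bar>p i - p0\<bar>) \<le> (\<Sum>i<n. (p i - p0) + 2 * p0)"
      using p p0 by (intro sum_mono) (auto simp: abs_if)
    also have "\<dots> = (\<Sum>i<n. p i - p0) + real n * (2 * p0)"
      by (subst sum.distrib) simp
    finally have "S \<le> (1 / real n) * ((\<Sum>i<n. p i - p0) + real n * (2 * p0))"
      unfolding S_def by (intro mult_left_mono) auto
    also have "\<dots> = (1 / real n) * (\<Sum>i<n. p i - p0) + 2 * p0"
      using npos by (simp add: field_simps)
    finally show ?thesis using D p0\<mu> by linarith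
  qed
  \<comment> \<open>as \<open>8 * rate \<le> S < 8 * \<mu>\<close>, the minimum in the rate is not attained at \<open>\<mu>\<close>\<close>
  have "8 * rate \<mu> n t \<le> C * rate \<mu> n t" using C rpos by (intro mult_right_mono) auto
  then have "rate \<mu> n t < \<mu>" using S S_lt by linarith
  then have r_ge: "rate \<mu> n t \<ge> sqrt \<mu> / (sqrt (real t) * real n powr (1 / 4))"
    by (auto simp: rate_def min_rate_def)
  have S2: "S\<^sup>2 \<ge> A * (\<mu> * x)"
  proof -
    have "\<mu> * x = (sqrt \<mu> / (sqrt (real t) * real n powr (1 / 4)))\<^sup>2"
      using square_root_rate[OF \<mu> n, of t] by (simp add: x_def T_def s_def)
    also have "\<dots> \<le> (rate \<mu> n t)\<^sup>2" using r_ge \<mu> by (intro power_mono) auto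
    finally have "A * (\<mu> * x) \<le> A * (rate \<mu> n t)\<^sup>2" using A by (intro mult_left_mono) auto
    also have "\<dots> = (C * rate \<mu> n t)\<^sup>2" by (simp add: A_def power_mult_distrib)
    also have "\<dots> \<le> S\<^sup>2" using S C rpos by (intro power_mono) auto
    finally show ?thesis .
  qed
  have M_ge: "S\<^sup>2 \<le> M"
  proof -
    have "(\<Sum>i<n. \<bar>p i - p0\<bar>)\<^sup>2 \<le> (\<Sum>i<n. \<bar>p i - p0\<bar>\<^sup>2) * real (card {..<n})"
      by (rule sum_squared_le_sum_of_squares)
    then have "(\<Sum>i<n. \<bar>p i - p0\<bar>)\<^sup>2 / (real n)\<^sup>2 \<le> (\<Sum>i<n. (p i - p0)\<^sup>2) * real n / (real n)\<^sup>2"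
      by (intro divide_right_mono) auto
    then show ?thesis
      using npos by (simp add: S_def M_def power_divide power2_eq_square[of "real n"])
  qed
  have Mpos: "M > 0" using M_ge zero_less_power[OF Spos, of 2] by linarith
  have g: "g > 0" "g\<^sup>2 = M" using Mpos by (auto simp: g_def)
  have Sg: "S \<le> g" unfolding g_def using M_ge by (rule real_le_rsqrt)
  have i: "\<mu> * x \<le> g\<^sup>2 / A" using S2 M_ge A g by (simp add: field_simps)
  have ii: "x \<le> 8 * g / A"
  proof -
    have "A * (S * x) \<le> A * (8 * \<mu> * x)" using S_lt xpos A by (intro mult_left_mono mult_right_mono) auto
    also have "\<dots> \<le> 8 * S\<^sup>2" using S2 by simp
    finally have "S * (A * x) \<le> S * (8 * S)" by (simp add: power2_eq_square mult_ac)
    then have "A * x \<le> 8 * S" using Spos by simp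
    then have "A * x \<le> 8 * g" using Sg by linarith
    then show ?thesis using A by (simp add: field_simps)
  qed
  have TT: "1 / (T * (T - 1)) \<le> 2 / T\<^sup>2"
    using T by (simp add: divide_simps power2_eq_square)
  have x2: "x\<^sup>2 = 1 / (T\<^sup>2 * real n)"
    by (simp add: x_def power_divide power_mult_distrib power2_eq_square[of s] s)
  have "measure_pmf.prob (bin_prod n t p) {X. psi n t 2 a p0 X = 0}
      \<le> (\<Sum>i<n. 2 * (p i * (1 - p i))\<^sup>2 / (real t * (real t - 1)) + 4 * (p i - p0)\<^sup>2 * (p i * (1 - p i)) / real t)
          / (real n)\<^sup>2 / (M / 2)\<^sup>2"
  proof (rule psi_type2[where mm = "\<lambda>q. (q - p0)\<^sup>2" and
      vv = "\<lambda>q. 2 * (q * (1 - q))\<^sup>2 / (real t * (real t - 1)) + 4 * (q - p0)\<^sup>2 * (q * (1 - q)) / real t"])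
    show "(2 * (p0 * (1 - p0))\<^sup>2 / (real t * (real t - 1)) + 4 * (p0 - p0)\<^sup>2 * (p0 * (1 - p0)) / real t)
        / (real n * (M / 2)\<^sup>2) \<le> a"
    proof -
      have "(2 * (p0 * (1 - p0))\<^sup>2 / (real t * (real t - 1)) + 4 * (p0 - p0)\<^sup>2 * (p0 * (1 - p0)) / real t)
        / (real n * (M / 2)\<^sup>2) = (1 / (T * (T - 1))) * (8 * \<mu>\<^sup>2 / (real n * M\<^sup>2))"
        by (simp add: \<mu>_def T_def power_divide)
      also have "\<dots> \<le> (2 / T\<^sup>2) * (8 * \<mu>\<^sup>2 / (real n * M\<^sup>2))"
        by (intro mult_right_mono TT) auto
      also have "\<dots> = 16 * (\<mu> * x)\<^sup>2 / M\<^sup>2" by (simp add: power_mult_distrib x2)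
      also have "\<dots> \<le> 16 * (g\<^sup>2 / A)\<^sup>2 / M\<^sup>2"
        using i \<mu> xpos by (intro divide_right_mono mult_left_mono power_mono) auto
      also have "\<dots> = 16 / (A * A)" using g Mpos by (simp add: power_divide power2_eq_square[of A])
      also have "\<dots> \<le> 16 / (C * 1)"
        using A C by (intro divide_left_mono mult_mono) auto
      finally show ?thesis using a by simp
    qed
  qed (use p p0 n t a Mpos kravchuk_2_moments in \<open>auto simp: M_def\<close>)
  also have "\<dots> \<le> (556 * g ^ 4 / A) / (M / 2)\<^sup>2"
  proof (intro divide_right_mono)
    have "(\<Sum>i<n. 2 * (p i * (1 - p i))\<^sup>2 / (real t * (real t - 1)) + 4 * (p i - p0)\<^sup>2 * (p i * (1 - p i)) / real t)
       \<le> (\<Sum>i<n. 8 * \<mu>\<^sup>2 / T\<^sup>2 + 8 * (d i)\<^sup>2 / T\<^sup>2 + 4 * \<mu> * (d i)\<^sup>2 / T + 4 * \<bar>d i\<bar> ^ 3 / T)"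
    proof (rule sum_mono)
      fix i assume "i \<in> {..<n}"
      then have pi: "p i \<in> {0..1}" using p by simp
      define v where "v = p i * (1 - p i)"
      have v0: "v \<ge> 0" using pi by (simp add: v_def)
      have v: "v \<le> \<mu> + \<bar>d i\<bar>"
        unfolding v_def \<mu>_def d_def by (rule bernoulli_variance_le[OF pi p0(1)])
      have "v\<^sup>2 \<le> (\<mu> + \<bar>d i\<bar>)\<^sup>2" using v v0 by (intro power_mono) auto
      also have "\<dots> \<le> 2 * (\<mu>\<^sup>2 + (d i)\<^sup>2)"
        using sum_squares_bound[of \<mu> "\<bar>d i\<bar>"] by (simp add: power2_sum)
      finally have v2: "v\<^sup>2 \<le> 2 * (\<mu>\<^sup>2 + (d i)\<^sup>2)" .
      have "2 * v\<^sup>2 / (T * (T - 1)) = (1 / (T * (T - 1))) * (2 * v\<^sup>2)" by simp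
      also have "\<dots> \<le> (2 / T\<^sup>2) * (2 * (2 * (\<mu>\<^sup>2 + (d i)\<^sup>2)))"
        using v2 by (intro mult_mono TT) auto
      also have "\<dots> = 8 * \<mu>\<^sup>2 / T\<^sup>2 + 8 * (d i)\<^sup>2 / T\<^sup>2" by (simp add: add_divide_distrib)
      finally have 1: "2 * v\<^sup>2 / (T * (T - 1)) \<le> 8 * \<mu>\<^sup>2 / T\<^sup>2 + 8 * (d i)\<^sup>2 / T\<^sup>2" .
      have "4 * (d i)\<^sup>2 * v / T \<le> 4 * (d i)\<^sup>2 * (\<mu> + \<bar>d i\<bar>) / T"
        using v T by (intro divide_right_mono mult_left_mono) auto
      also have "\<dots> = 4 * \<mu> * (d i)\<^sup>2 / T + 4 * \<bar>d i\<bar> ^ 3 / T"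
        by (simp add: add_divide_distrib distrib_left power3_eq_cube power2_eq_square mult_ac)
      finally have 2: "4 * (d i)\<^sup>2 * v / T \<le> 4 * \<mu> * (d i)\<^sup>2 / T + 4 * \<bar>d i\<bar> ^ 3 / T" .
      show "2 * (p i * (1 - p i))\<^sup>2 / (real t * (real t - 1)) + 4 * (p i - p0)\<^sup>2 * (p i * (1 - p i)) / real t
        \<le> 8 * \<mu>\<^sup>2 / T\<^sup>2 + 8 * (d i)\<^sup>2 / T\<^sup>2 + 4 * \<mu> * (d i)\<^sup>2 / T + 4 * \<bar>d i\<bar> ^ 3 / T"
        using 1 2 unfolding v_def T_def d_def by linarith
    qed
    also have "\<dots> = real n * (8 * \<mu>\<^sup>2 / T\<^sup>2) + 8 * (\<Sum>i<n. (d i)\<^sup>2) / T\<^sup>2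
        + 4 * \<mu> * (\<Sum>i<n. (d i)\<^sup>2) / T + 4 * (\<Sum>i<n. \<bar>d i\<bar> ^ 3) / T"
      by (simp add: sum.distrib sum_divide_distrib sum_distrib_left)
    also have "\<dots> \<le> real n * (8 * \<mu>\<^sup>2 / T\<^sup>2) + 8 * (real n * M) / T\<^sup>2
        + 4 * \<mu> * (real n * M) / T + 4 * ((s * g) * (real n * M)) / T"
    proof -
      have nM: "(\<Sum>i<n. (d i)\<^sup>2) = real n * M" using npos by (simp add: M_def d_def)
      have "(\<Sum>i<n. \<bar>d i\<bar> ^ 3) \<le> (s * g) * (real n * M)"
        using sum_cube_le[of d n] unfolding nM by (simp add: s_def g_def real_sqrt_mult)
      then have "4 * (\<Sum>i<n. \<bar>d i\<bar> ^ 3) / T \<le> 4 * ((s * g) * (real n * M)) / T"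
        using T by (intro divide_right_mono) auto
      then show ?thesis unfolding nM by linarith
    qed
    also have "\<dots> = (8 * (\<mu> * x)\<^sup>2 + 8 * g\<^sup>2 * x\<^sup>2 + 4 * (\<mu> * x) * g\<^sup>2 / s + 4 * g ^ 3 * x) * (real n)\<^sup>2"
    proof -
      have ne: "T \<noteq> 0" "s \<noteq> 0" using T s by auto
      have xT: "x * s = 1 / T" using ne by (simp add: x_def)
      have e1: "real n * (8 * \<mu>\<^sup>2 / T\<^sup>2) = 8 * (\<mu> * x)\<^sup>2 * (real n)\<^sup>2"
        using npos by (simp add: power_mult_distrib x2 power2_eq_square[of "real n"])
      have e2: "8 * (real n * M) / T\<^sup>2 = 8 * g\<^sup>2 * x\<^sup>2 * (real n)\<^sup>2"
        using npos by (simp add: x2 g power2_eq_square[of "real n"])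
      have e3: "4 * \<mu> * (real n * M) / T = 4 * (\<mu> * x) * g\<^sup>2 / s * (real n)\<^sup>2"
        unfolding g(2) using ne by (simp add: x_def s(2)[symmetric] power2_eq_square)
      have e4: "4 * ((s * g) * (real n * M)) / T = 4 * g ^ 3 * x * (real n)\<^sup>2"
        using ne by (simp add: x_def g(2)[symmetric] power2_eq_square power3_eq_cube s(2)[symmetric])
      show ?thesis unfolding e1 e2 e3 e4 by (simp add: distrib_right)
    qed
    also have "\<dots> \<le> (556 * g ^ 4 / A) * (real n)\<^sup>2"
      using quadratic_variance_algebra[OF \<mu> g(1) _ s(1) A(1) i ii] xpos
      by (intro mult_right_mono) auto
    finally show "(\<Sum>i<n. 2 * (p i * (1 - p i))\<^sup>2 / (real t * (real t - 1)) + 4 * (p i - p0)\<^sup>2 * (p i * (1 - p i)) / real t)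
        / (real n)\<^sup>2 \<le> 556 * g ^ 4 / A"
      using npos by (simp add: pos_divide_le_eq)
  qed auto
  also have "\<dots> = 2224 / A"
  proof -
    have "g ^ 4 = M\<^sup>2" by (simp flip: g(2) power_mult)
    then show ?thesis using Mpos by (simp add: power_divide)
  qed
  also have "\<dots> \<le> 2224 / C" using A C by (intro divide_left_mono) auto
  finally show ?thesis .
qed

lemma psi_LM_lower_type2_product:
  fixes p :: "nat \<Rightarrow> real"
  assumes p: "\<And>i. i < n \<Longrightarrow> p i \<in> {0..1}" and p0: "p0 \<in> {0..1}" "p0 \<le> 1 / 2"
    and n: "n \<ge> 1" and t: "t \<ge> 2" and C: "C \<ge> 8" and a: "32 / C \<le> \<alpha>" "\<alpha> < 1"
    and S: "(1 / real n) * (\<Sum>i<n. \<bar>p i - p0\<bar>) \<ge> C * rate (p0 * (1 - p0)) n t"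
  shows "measure_pmf.prob (bin_prod n t p) {X. psi_LM_lower n t \<alpha> p0 X = 0} \<le> 2224 / C"
proof -
  have a': "16 / C \<le> \<alpha> / 2" "\<alpha> / 2 < 1" using a by auto
  have sub: "measure_pmf.prob (bin_prod n t p) {X. psi_LM_lower n t \<alpha> p0 X = 0}
      \<le> measure_pmf.prob (bin_prod n t p) {X. psi n t m (\<alpha> / 2) p0 X = 0}" if "m = 1 \<or> m = 2" for m
    using that by (intro measure_pmf.finite_measure_mono) (auto simp: psi_LM_lower_def)
  show ?thesis
  proof (cases "(1 / real n) * (\<Sum>i<n. p i - p0) \<ge> (1 / real n) * (\<Sum>i<n. \<bar>p i - p0\<bar>) / 2")
    case True
    have "measure_pmf.prob (bin_prod n t p) {X. psi n t 1 (\<alpha> / 2) p0 X = 0} \<le> 32 / C"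
      by (rule psi_1_type2[OF p p0(1) n _ _ a' S True]) (use t C in auto)
    also have "\<dots> \<le> 2224 / C" using C by (intro divide_right_mono) auto
    finally show ?thesis using sub[of 1] by simp
  next
    case False
    have "measure_pmf.prob (bin_prod n t p) {X. psi n t 2 (\<alpha> / 2) p0 X = 0} \<le> 2224 / C"
      by (rule psi_2_type2[OF p p0 n t C a' S]) (use False in auto)
    then show ?thesis using sub[of 2] by simp
  qed
qed

lemma psi_LM_type2_product:
  fixes p :: "nat \<Rightarrow> real"
  assumes p: "\<And>i. i < n \<Longrightarrow> p i \<in> {0..1}" and p0: "p0 \<in> {0..1}"
    and n: "n \<ge> 1" and t: "t \<ge> 2" and C: "C \<ge> 8" and a: "32 / C \<le> \<alpha>" "\<alpha> < 1"
    and S: "(1 / real n) * (\<Sum>i<n. \<bar>p i - p0\<bar>) \<ge> C * rate (p0 * (1 - p0)) n t"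
  shows "measure_pmf.prob (bin_prod n t p) {X. psi_LM n t \<alpha> p0 X = 0} \<le> 2224 / C"
proof (cases "p0 \<le> 1 / 2")
  case True
  then show ?thesis using psi_LM_lower_type2_product[OF p p0 True n t C a S] by (simp add: psi_LM_def)
next
  case False
  have "measure_pmf.prob (bin_prod n t p) {X. psi_LM_lower n t \<alpha> (1 - p0) (\<lambda>i. t - X i) = 0}
      = measure_pmf.prob (bin_prod n t (\<lambda>i. 1 - p i)) {X. psi_LM_lower n t \<alpha> (1 - p0) X = 0}"
    using p psi_LM_lower_cong
    by (intro prob_bin_prod_reflect[where Q = "\<lambda>X. psi_LM_lower n t \<alpha> (1 - p0) X = 0"]) metis+
  also have "\<dots> \<le> 2224 / C"
  proof (rule psi_LM_lower_type2_product[OF _ _ _ n t C a])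
    have "\<bar>1 - p i - (1 - p0)\<bar> = \<bar>p i - p0\<bar>" for i by linarith
    then show "(1 / real n) * (\<Sum>i<n. \<bar>1 - p i - (1 - p0)\<bar>) \<ge> C * rate ((1 - p0) * (1 - (1 - p0))) n t"
      using S by (simp add: mult.commute)
  qed (use p p0 False in auto)
  finally show ?thesis using False by (simp add: psi_LM_def)
qed

text \<open>
  The constant \<open>2226\<close> collects \<open>2224\<close> from the conditional error given the success probabilities and
  \<open>2\<close> from the event that their realised mean distance to \<open>p0\<close> falls below half of its expectation.
\<close>

lemma max_type2_psi_LM_le:
  assumes p0: "p0 \<in> {0..1}" and n: "n \<ge> 1" and t: "t \<ge> 2"
    and C: "C \<ge> 8" "32 / C \<le> \<alpha>" "\<alpha> < 1" "2226 / C \<le> \<beta>"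
    and \<epsilon>: "\<epsilon> \<ge> 2 * C * rate (p0 * (1 - p0)) n t"
  shows "max_type2 n t (point_mass p0) (psi_LM n t \<alpha> p0) \<epsilon> \<le> \<beta>"
proof -
  let ?r = "rate (p0 * (1 - p0)) n t"
  have "2226 / C \<ge> 0" using C(1) by simp
  with C(4) have \<beta>: "\<beta> \<ge> 0" by linarith
  have r: "?r \<ge> 1 / real n" by (simp add: rate_def)
  have npos: "real n > 0" using n by simp
  then have "1 / real n > 0" by simp
  with r have rpos: "?r > 0" by linarith
  have "measure_pmf.prob (binmix_prod n t \<pi>) {X. psi_LM n t \<alpha> p0 X = 0} \<le> \<beta>"
    if \<pi>: "\<pi> \<in> mixing_dists" and W: "W1 \<pi> (point_mass p0) \<ge> \<epsilon>" for \<pi>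
  proof -
    define W where "W = (\<integral>p. \<bar>p - p0\<bar> \<partial>\<pi>)"
    have W_ge: "W \<ge> 2 * C * ?r" using W \<epsilon> W1_point_mass[OF \<pi> p0] by (simp add: W_def)
    have "2 * C * ?r > 0" using C rpos by simp
    then have Wpos: "W > 0" using W_ge by linarith
    have "measure_pmf.prob (binmix_prod n t \<pi>) {X. psi_LM n t \<alpha> p0 X = 0} \<le> 2224 / C + 4 / (real n * W)"
      unfolding W_def
    proof (rule prob_binmix_prod_le[OF \<pi> p0 n])
      fix p :: "nat \<Rightarrow> real"
      assume p: "\<And>i. i < n \<Longrightarrow> p i \<in> {0..1}"
        and S: "(1 / real n) * (\<Sum>i<n. \<bar>p i - p0\<bar>) > (\<integral>p. \<bar>p - p0\<bar> \<partial>\<pi>) / 2"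
      have S': "(1 / real n) * (\<Sum>i<n. \<bar>p i - p0\<bar>) \<ge> C * ?r"
        using S W_ge unfolding W_def[symmetric] by linarith
      show "measure_pmf.prob (bin_prod n t p) {X. psi_LM n t \<alpha> p0 X = 0} \<le> 2224 / C"
        by (rule psi_LM_type2_product[OF p p0 n t C(1-3) S'])
    qed (use Wpos C in \<open>auto simp: W_def\<close>)
    also have "4 / (real n * W) \<le> 4 / (2 * C)"
    proof (rule divide_left_mono)
      have "2 * C * (1 / real n) \<le> 2 * C * ?r" using r C by (intro mult_left_mono) auto
      then have "2 * C * (1 / real n) \<le> W" using W_ge by linarith
      then show "2 * C \<le> real n * W" using npos by (simp add: field_simps)
    qed (use npos Wpos C in auto)
    also have "2224 / C + 4 / (2 * C) = 2226 / C" using C by (simp add: field_simps)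
    finally show ?thesis using C(4) by simp
  qed
  then show ?thesis
    unfolding max_type2_def using \<beta> by (intro cSup_least) auto
qed

section \<open>Lower bounds by two-point mixtures\<close>

text \<open>
  The mixing distribution \<open>w \<delta>\<^sub>x + (1 - w) \<delta>\<^sub>y\<close>, as the image of a Bernoulli distribution.
\<close>

definition two_point :: "real \<Rightarrow> real \<Rightarrow> real \<Rightarrow> real measure" where
  "two_point w x y = distr (measure_pmf (bernoulli_pmf w)) unit_borel (\<lambda>b. if b then x else y)"

lemma two_point_mixing_dists:
  assumes "x \<in> {0..1}" "y \<in> {0..1}"
  shows "two_point w x y \<in> mixing_dists"
  using assms unfolding two_point_def mixing_dists_def
  by (auto intro!: measure_pmf.prob_space_distr simp: space_restrict_space)

lemma integral_two_point:
  fixes f :: "real \<Rightarrow> real"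
  assumes "x \<in> {0..1}" "y \<in> {0..1}" "w \<in> {0..1}" "f \<in> borel_measurable borel"
  shows "(\<integral>p. f p \<partial>two_point w x y) = w * f x + (1 - w) * f y"
proof -
  have "(\<integral>p. f p \<partial>two_point w x y) = (\<integral>b. f (if b then x else y) \<partial>measure_pmf (bernoulli_pmf w))"
    unfolding two_point_def using assms
    by (intro integral_distr measurable_restrict_space1) (auto simp: space_restrict_space)
  also have "\<dots> = w * f x + (1 - w) * f y"
    using assms(3) by (subst integral_bernoulli_pmf) auto
  finally show ?thesis .
qed

lemma W1_two_point:
  assumes "x \<in> {0..1}" "y \<in> {0..1}" "w \<in> {0..1}" "p0 \<in> {0..1}"
  shows "W1 (two_point w x y) (point_mass p0) = w * \<bar>x - p0\<bar> + (1 - w) * \<bar>y - p0\<bar>"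
  using assms by (simp add: W1_point_mass two_point_mixing_dists integral_two_point)

lemma pmf_binmix_two_point:
  assumes "x \<in> {0..1}" "y \<in> {0..1}" "w \<in> {0..1}"
  shows "pmf (binmix t (two_point w x y)) j
    = w * pmf (binomial_pmf t x) j + (1 - w) * pmf (binomial_pmf t y) j"
  using assms by (simp add: pmf_binmix[OF two_point_mixing_dists] integral_two_point)

lemma pmf_binmix_prod:
  assumes "X \<in> samples n t"
  shows "pmf (binmix_prod n t \<pi>) X = (\<Prod>i<n. pmf (binmix t \<pi>) (X i))"
  unfolding binmix_prod_def using assms by (intro pmf_Pi') (auto simp: samples_def PiE_dflt_def)

text \<open>
  Le Cam's argument for a simple alternative \<open>\<pi>\<close>: \<open>\<eta>\<close> bounds the total variation
  distance of the two sample distributions.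
\<close>

lemma local_risk_ge:
  assumes \<alpha>: "\<alpha> \<ge> 0" and p0: "p0 \<in> {0..1}"
    and \<pi>: "\<pi> \<in> mixing_dists" "W1 \<pi> (point_mass p0) \<ge> \<epsilon>"
    and close: "\<And>A. measure_pmf.prob (binmix_prod n t (point_mass p0)) A - \<eta>
                  \<le> measure_pmf.prob (binmix_prod n t \<pi>) A"
  shows "1 - \<alpha> - \<eta> \<le> local_risk \<alpha> n t \<epsilon> (point_mass p0)"
  unfolding local_risk_def
proof (rule cINF_greatest)
  have "(\<lambda>_. 0) \<in> level_tests \<alpha> n t (point_mass p0)"
    using \<alpha> by (auto simp: level_tests_def tests_def)
  then show "level_tests \<alpha> n t (point_mass p0) \<noteq> {}" by blast
  fix \<psi> assume \<psi>: "\<psi> \<in> level_tests \<alpha> n t (point_mass p0)"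
  let ?P0 = "binmix_prod n t (point_mass p0)"
  have "AE X in ?P0. \<psi> X = 0 \<or> \<psi> X = 1"
    using \<psi> set_pmf_binmix_prod[OF point_mass_mixing_dists[OF p0], of n t]
    by (auto simp: AE_measure_pmf_iff level_tests_def tests_def Pi_def)
  then have "1 = measure_pmf.prob ?P0 ({X. \<psi> X = 0} \<union> {X. \<psi> X = 1})"
    by (subst eq_commute, subst measure_pmf.prob_eq_1) auto
  also have "\<dots> \<le> measure_pmf.prob ?P0 {X. \<psi> X = 0} + measure_pmf.prob ?P0 {X. \<psi> X = 1}"
    by (rule measure_Un_le) auto
  also have "measure_pmf.prob ?P0 {X. \<psi> X = 1} \<le> \<alpha>" using \<psi> by (simp add: level_tests_def)
  finally have "1 - \<alpha> - \<eta> \<le> measure_pmf.prob ?P0 {X. \<psi> X = 0} - \<eta>" by simp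
  also have "\<dots> \<le> measure_pmf.prob (binmix_prod n t \<pi>) {X. \<psi> X = 0}" by (rule close)
  also have "\<dots> \<le> max_type2 n t (point_mass p0) \<psi> \<epsilon>"
    unfolding max_type2_def using \<pi>
    by (intro cSup_upper bdd_aboveI[of _ 1]) auto
  finally show "1 - \<alpha> - \<eta> \<le> max_type2 n t (point_mass p0) \<psi> \<epsilon>" .
qed

text \<open>
  A contamination of mass \<open>a / n\<close> is not sampled at all with probability
  \<open>(1 - a / n)\<^sup>n \<ge> 1 - a\<close>.
\<close>

lemma contamination_close:
  assumes n: "n \<ge> 1" and a: "0 \<le> a" "a \<le> 1" and e: "e \<in> {0..1}" and p0: "p0 \<in> {0..1}"
  shows "measure_pmf.prob (binmix_prod n t (point_mass p0)) A - a
    \<le> measure_pmf.prob (binmix_prod n t (two_point (a / real n) e p0)) A"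
proof -
  let ?\<pi> = "two_point (a / real n) e p0"
  let ?B = "binmix_prod n t (point_mass p0)" and ?Q = "binmix_prod n t ?\<pi>"
  have w: "a / real n \<in> {0..1}" using n a by (auto simp: divide_simps)
  have \<pi>: "?\<pi> \<in> mixing_dists" by (rule two_point_mixing_dists[OF e p0])
  have pm: "(1 - a) * pmf ?B X \<le> pmf ?Q X" if X: "X \<in> samples n t" for X
  proof -
    have "1 - a = 1 + real n * (- (a / real n))" using n by simp
    also have "\<dots> \<le> (1 + (- (a / real n))) ^ n"
      using w by (intro Bernoulli_inequality) auto
    finally have "(1 - a) * pmf ?B X \<le> (1 - a / real n) ^ n * pmf ?B X"
      by (intro mult_right_mono) auto
    also have "\<dots> = (\<Prod>i<n. (1 - a / real n) * pmf (binmix t (point_mass p0)) (X i))"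
      by (simp add: pmf_binmix_prod[OF X] prod.distrib)
    also have "\<dots> \<le> (\<Prod>i<n. pmf (binmix t ?\<pi>) (X i))"
    proof (rule prod_mono)
      fix i assume "i \<in> {..<n}"
      show "0 \<le> (1 - a / real n) * pmf (binmix t (point_mass p0)) (X i) \<and>
          (1 - a / real n) * pmf (binmix t (point_mass p0)) (X i) \<le> pmf (binmix t ?\<pi>) (X i)"
        unfolding pmf_binmix_two_point[OF e p0 w] binmix_point_mass[OF p0] using w a by auto
    qed
    also have "\<dots> = pmf ?Q X" by (simp add: pmf_binmix_prod[OF X])
    finally show ?thesis .
  qed
  have "measure_pmf.prob ?B A - a \<le> (1 - a) * measure_pmf.prob ?B A"
    using mult_left_mono[OF measure_pmf.prob_le_1[of ?B A] a(1)] by (simp add: algebra_simps)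
  also have "\<dots> = (\<Sum>X\<in>samples n t \<inter> A. (1 - a) * pmf ?B X)"
    unfolding prob_eq_sum_samples[OF set_pmf_binmix_prod[OF point_mass_mixing_dists[OF p0]]]
    by (rule sum_distrib_left)
  also have "\<dots> \<le> (\<Sum>X\<in>samples n t \<inter> A. pmf ?Q X)" by (intro sum_mono pm) auto
  also have "\<dots> = measure_pmf.prob ?Q A"
    by (rule prob_eq_sum_samples[OF set_pmf_binmix_prod[OF \<pi>], symmetric])
  finally show ?thesis .
qed

text \<open>
  A bound on the total variation distance of \<open>B\<close> and \<open>Q\<close> by the chi-square divergence. The inequality
  \<open>1 - l \<le> (1 - l)\<^sup>2 / (2 \<eta>) + \<eta> / 2\<close> for the likelihood ratio \<open>l\<close> replaces the
  Cauchy-Schwarz inequality.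
\<close>

lemma chi_square_close:
  fixes B Q :: "'a \<Rightarrow> real"
  assumes \<Omega>: "finite \<Omega>" "A \<subseteq> \<Omega>" and B: "\<And>x. x \<in> \<Omega> \<Longrightarrow> B x > 0"
    and sums: "sum B \<Omega> = 1" "sum Q \<Omega> = 1" and \<eta>: "\<eta> > 0"
    and chi: "(\<Sum>x\<in>\<Omega>. (Q x)\<^sup>2 / B x) \<le> 1 + \<eta>\<^sup>2"
  shows "sum B A - sum Q A \<le> \<eta>"
proof -
  have key: "B x - Q x \<le> ((Q x)\<^sup>2 / B x - 2 * Q x + B x) / (2 * \<eta>) + \<eta> / 2 * B x"
    and nn: "0 \<le> ((Q x)\<^sup>2 / B x - 2 * Q x + B x) / (2 * \<eta>) + \<eta> / 2 * B x" if "x \<in> \<Omega>" for x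
  proof -
    define l where "l = Q x / B x"
    have b: "B x > 0" by (rule B[OF that])
    have Q: "Q x = l * B x" using b by (simp add: l_def)
    have e: "(Q x)\<^sup>2 / B x - 2 * Q x + B x = B x * (1 - l)\<^sup>2"
      using b unfolding Q by (simp add: power2_eq_square algebra_simps)
    have "0 \<le> ((1 - l) - \<eta>)\<^sup>2" by simp
    then have "2 * \<eta> * (1 - l) \<le> (1 - l)\<^sup>2 + \<eta>\<^sup>2" by (simp add: power2_diff mult_ac)
    then have "(1 - l) \<le> (1 - l)\<^sup>2 / (2 * \<eta>) + \<eta> / 2"
      using \<eta> by (simp add: field_simps power2_eq_square)
    then have "B x * (1 - l) \<le> B x * ((1 - l)\<^sup>2 / (2 * \<eta>) + \<eta> / 2)"
      using b by (intro mult_left_mono) auto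
    then show "B x - Q x \<le> ((Q x)\<^sup>2 / B x - 2 * Q x + B x) / (2 * \<eta>) + \<eta> / 2 * B x"
      unfolding e unfolding Q by (simp add: algebra_simps)
    show "0 \<le> ((Q x)\<^sup>2 / B x - 2 * Q x + B x) / (2 * \<eta>) + \<eta> / 2 * B x"
      unfolding e using b \<eta> by simp
  qed
  have "sum B A - sum Q A = (\<Sum>x\<in>A. B x - Q x)" by (simp add: sum_subtractf)
  also have "\<dots> \<le> (\<Sum>x\<in>A. ((Q x)\<^sup>2 / B x - 2 * Q x + B x) / (2 * \<eta>) + \<eta> / 2 * B x)"
    using \<Omega> by (intro sum_mono key) auto
  also have "\<dots> \<le> (\<Sum>x\<in>\<Omega>. ((Q x)\<^sup>2 / B x - 2 * Q x + B x) / (2 * \<eta>) + \<eta> / 2 * B x)"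
    using \<Omega> nn by (intro sum_mono2) auto
  also have "\<dots> = ((\<Sum>x\<in>\<Omega>. (Q x)\<^sup>2 / B x) - 2 * sum Q \<Omega> + sum B \<Omega>) / (2 * \<eta>) + \<eta> / 2 * sum B \<Omega>"
    by (simp only: sum.distrib sum_subtractf sum_divide_distrib[symmetric] sum_distrib_left[symmetric])
  also have "\<dots> \<le> \<eta>\<^sup>2 / (2 * \<eta>) + \<eta> / 2"
    unfolding sums using chi \<eta> by (intro add_mono divide_right_mono) auto
  also have "\<dots> = \<eta>" using \<eta> by (simp add: power2_eq_square)
  finally show ?thesis .
qed

text \<open>
  The mixed second moments, under the null distribution, of the likelihood ratios of binomial distributions.
\<close>

lemma binomial_affinity:
  fixes p0 u v :: real and t :: nat
  assumes p0: "0 < p0" "p0 < 1"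
  defines "b \<equiv> \<lambda>q j. real (t choose j) * q ^ j * (1 - q) ^ (t - j)"
  shows "(\<Sum>j\<le>t. b (p0 + u) j * b (p0 + v) j / b p0 j) = (1 + u * v / (p0 * (1 - p0))) ^ t"
proof -
  let ?X = "(p0 + u) * (p0 + v) / p0" and ?Y = "(1 - (p0 + u)) * (1 - (p0 + v)) / (1 - p0)"
  have "(\<Sum>j\<le>t. b (p0 + u) j * b (p0 + v) j / b p0 j) = (\<Sum>j\<le>t. real (t choose j) * ?X ^ j * ?Y ^ (t - j))"
  proof (rule sum.cong)
    fix j assume "j \<in> {..t}"
    then have "real (t choose j) \<noteq> 0" by simp
    then show "b (p0 + u) j * b (p0 + v) j / b p0 j = real (t choose j) * ?X ^ j * ?Y ^ (t - j)"
      by (simp add: b_def power_divide power_mult_distrib)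
  qed simp
  also have "\<dots> = (?X + ?Y) ^ t" by (rule binomial_ring[symmetric])
  also have "?X + ?Y = 1 + u * v / (p0 * (1 - p0))"
    using p0 by (simp add: divide_simps) (simp add: algebra_simps)
  finally show ?thesis .
qed

text \<open>
  Averaging over the signs of a symmetric pair cancels the odd powers of \<open>x\<close>, so the bound is quadratic in \<open>t x\<close>.
\<close>

lemma even_part_power_le:
  fixes x :: real
  assumes x: "0 \<le> x" "x \<le> 1" "real t * x \<le> 1"
  shows "((1 + x) ^ t + (1 - x) ^ t) / 2 \<le> 1 + (real t * x)\<^sup>2"
proof -
  define y where "y = real t * x"
  have y: "0 \<le> y" "y \<le> 1" using x by (auto simp: y_def)
  have "(1 + x) ^ t \<le> exp x ^ t" using x by (intro power_mono) auto
  also have "\<dots> = exp y" by (simp add: y_def exp_of_nat_mult)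
  also have "\<dots> \<le> 1 + y + y\<^sup>2" using y by (intro exp_bound) auto
  finally have 1: "(1 + x) ^ t \<le> 1 + y + y\<^sup>2" .
  have "1 - x \<le> exp (- x)" using exp_ge_add_one_self[of "- x"] by simp
  then have "(1 - x) ^ t \<le> exp (- x) ^ t" using x by (intro power_mono) auto
  also have "\<dots> = exp (- y)" unfolding y_def by (metis exp_of_nat_mult mult_minus_right)
  also have "\<dots> = 1 / exp y" by (simp add: exp_minus inverse_eq_divide)
  also have "\<dots> \<le> 1 / (1 + y)" using y by (intro divide_left_mono) (auto intro: add_pos_nonneg)
  also have "\<dots> \<le> 1 - y + y\<^sup>2"
  proof -
    have "(1 - y + y\<^sup>2) * (1 + y) = 1 + y ^ 3" by (simp add: algebra_simps power2_eq_square power3_eq_cube)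
    then show ?thesis using y by (simp add: pos_divide_le_eq)
  qed
  finally have 2: "(1 - x) ^ t \<le> 1 - y + y\<^sup>2" .
  from 1 2 show ?thesis unfolding y_def[symmetric] by simp
qed

text \<open>
  Moving \<open>p0\<close> by \<open>\<plusminus>h\<close> with equal probability leaves the mean unchanged; the sample is
  indistinguishable from the null hypothesis as long as \<open>t h\<^sup>2 / \<mu>\<close> is of order \<open>1 / \<surd>n\<close>. The
  condition \<open>h \<le> \<mu>\<close> keeps \<open>p0 \<plusminus> h\<close> in the unit interval.
\<close>

lemma symmetric_pair_close:
  assumes p0: "0 < p0" "p0 < 1" and n: "n \<ge> 1" and \<eta>: "0 < \<eta>" "\<eta> \<le> 1"
    and h: "0 \<le> h" "h \<le> p0 * (1 - p0)"
    and small: "real n * (real t * (h\<^sup>2 / (p0 * (1 - p0))))\<^sup>2 \<le> \<eta>\<^sup>2 / 2"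
  shows "measure_pmf.prob (binmix_prod n t (point_mass p0)) A - \<eta>
    \<le> measure_pmf.prob (binmix_prod n t (two_point (1 / 2) (p0 + h) (p0 - h))) A"
proof -
  let ?\<pi> = "two_point (1 / 2) (p0 + h) (p0 - h)"
  let ?B = "binmix_prod n t (point_mass p0)" and ?Q = "binmix_prod n t ?\<pi>"
  let ?b = "\<lambda>q j. real (t choose j) * q ^ j * (1 - q) ^ (t - j) :: real"
  define \<mu> where "\<mu> = p0 * (1 - p0)"
  define x where "x = h\<^sup>2 / \<mu>"
  define y where "y = real t * x"
  have \<mu>: "0 < \<mu>" "\<mu> \<le> p0" "\<mu> \<le> 1 - p0" "\<mu> \<le> 1"
    using p0 by (auto simp: \<mu>_def mult_left_le mult_left_le_one_le mult_le_one)
  have h\<mu>: "h \<le> \<mu>" using h by (simp add: \<mu>_def)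
  have p0': "p0 \<in> {0..1}" and r: "p0 + h \<in> {0..1}" "p0 - h \<in> {0..1}" and w: "(1 / 2 :: real) \<in> {0..1}"
    using p0 h h\<mu> \<mu> by auto
  have \<pi>: "?\<pi> \<in> mixing_dists" by (rule two_point_mixing_dists[OF r])
  note \<pi>0 = point_mass_mixing_dists[OF p0']
  have x: "0 \<le> x" "x \<le> 1"
  proof -
    show "0 \<le> x" using \<mu> by (simp add: x_def)
    have "h\<^sup>2 \<le> \<mu>\<^sup>2" using h(1) h\<mu> by (intro power_mono) auto
    also have "\<dots> \<le> \<mu>" using \<mu> by (simp add: power2_eq_square mult_left_le)
    finally show "x \<le> 1" using \<mu> by (simp add: x_def)
  qed
  have ny: "real n * y\<^sup>2 \<le> \<eta>\<^sup>2 / 2" using small by (simp add: y_def x_def \<mu>_def)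
  have \<eta>2: "\<eta>\<^sup>2 / 2 \<le> 1" using \<eta> power_le_one[of \<eta> 2] by simp
  have y: "0 \<le> y" "y \<le> 1"
  proof -
    show "0 \<le> y" using x by (simp add: y_def)
    have "1 * y\<^sup>2 \<le> real n * y\<^sup>2" using n by (intro mult_right_mono) auto
    then have "y\<^sup>2 \<le> 1" using ny \<eta>2 by linarith
    then show "y \<le> 1" by (simp add: abs_square_le_1)
  qed
  have b0: "pmf (binmix t (point_mass p0)) j > 0" if "j \<le> t" for j
    unfolding binmix_point_mass[OF p0'] using that p0 by simp
  \<comment> \<open>second moment of the likelihood ratio of one observation\<close>
  have one: "(\<Sum>j\<le>t. (pmf (binmix t ?\<pi>) j)\<^sup>2 / pmf (binmix t (point_mass p0)) j) \<le> 1 + y\<^sup>2"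
  proof -
    have e: "(pmf (binmix t ?\<pi>) j)\<^sup>2 / pmf (binmix t (point_mass p0)) j
      = (?b (p0 + h) j * ?b (p0 + h) j / ?b p0 j + 2 * (?b (p0 + h) j * ?b (p0 + - h) j / ?b p0 j)
         + ?b (p0 + - h) j * ?b (p0 + - h) j / ?b p0 j) / 4" for j
    proof -
      have q: "pmf (binmix t ?\<pi>) j = (?b (p0 + h) j + ?b (p0 + - h) j) / 2"
        unfolding pmf_binmix_two_point[OF r w] using r by simp
      have b: "pmf (binmix t (point_mass p0)) j = ?b p0 j"
        unfolding binmix_point_mass[OF p0'] using p0' by simp
      have gen: "((X + Y) / 2)\<^sup>2 / Z = (X * X / Z + 2 * (X * Y / Z) + Y * Y / Z) / 4" for X Y Z :: real
        by (simp add: power2_eq_square add_divide_distrib algebra_simps)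
      show ?thesis unfolding q b by (rule gen)
    qed
    have "(\<Sum>j\<le>t. (pmf (binmix t ?\<pi>) j)\<^sup>2 / pmf (binmix t (point_mass p0)) j)
      = ((1 + h * h / (p0 * (1 - p0))) ^ t + 2 * (1 + h * - h / (p0 * (1 - p0))) ^ t
         + (1 + - h * - h / (p0 * (1 - p0))) ^ t) / 4"
      unfolding e by (simp only: sum_divide_distrib[symmetric] sum.distrib sum_distrib_left[symmetric] binomial_affinity[OF p0])
    also have "\<dots> = ((1 + x) ^ t + (1 - x) ^ t) / 2"
      by (simp add: x_def \<mu>_def power2_eq_square)
    also have "\<dots> \<le> 1 + y\<^sup>2"
      unfolding y_def using x y by (intro even_part_power_le) (auto simp: y_def)
    finally show ?thesis .
  qed
  have pos: "pmf ?B X > 0" if "X \<in> samples n t" for X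
    unfolding pmf_binmix_prod[OF that] using that
    by (intro prod_pos) (auto intro!: b0 simp: samples_def PiE_dflt_def)
  have "(\<Sum>X\<in>samples n t. (pmf ?Q X)\<^sup>2 / pmf ?B X)
      = (\<Sum>X\<in>samples n t. (\<Prod>i<n. (pmf (binmix t ?\<pi>) (X i) / pmf (binmix t (point_mass p0)) (X i))\<^sup>2) * pmf ?B X)"
  proof (rule sum.cong)
    fix X assume X: "X \<in> samples n t"
    have "(\<Prod>i<n. (pmf (binmix t ?\<pi>) (X i) / pmf (binmix t (point_mass p0)) (X i))\<^sup>2)
        = (pmf ?Q X / pmf ?B X)\<^sup>2"
      by (simp only: pmf_binmix_prod[OF X] prod_dividef[symmetric] prod_power_distrib)
    then show "(pmf ?Q X)\<^sup>2 / pmf ?B X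
      = (\<Prod>i<n. (pmf (binmix t ?\<pi>) (X i) / pmf (binmix t (point_mass p0)) (X i))\<^sup>2) * pmf ?B X"
      using pos[OF X] by (simp add: power_divide power2_eq_square)
  qed simp
  also have "\<dots> = measure_pmf.expectation ?B
      (\<lambda>X. \<Prod>i<n. (pmf (binmix t ?\<pi>) (X i) / pmf (binmix t (point_mass p0)) (X i))\<^sup>2)"
    by (rule integral_measure_pmf_real[symmetric, OF finite_samples])
       (use set_pmf_binmix_prod[OF \<pi>0] in auto)
  also have "\<dots> = (\<Prod>i<n. measure_pmf.expectation (binmix t (point_mass p0))
      (\<lambda>j. (pmf (binmix t ?\<pi>) j / pmf (binmix t (point_mass p0)) j)\<^sup>2))"
    unfolding binmix_prod_def
  proof (rule expectation_prod_Pi_pmf)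
    show "integrable (measure_pmf (binmix t (point_mass p0)))
        (\<lambda>j. (pmf (binmix t ?\<pi>) j / pmf (binmix t (point_mass p0)) j)\<^sup>2)"
      using set_pmf_binmix[OF \<pi>0, of t] by (intro integrable_measure_pmf_finite) (auto intro: finite_subset)
  qed auto
  also have "measure_pmf.expectation (binmix t (point_mass p0))
      (\<lambda>j. (pmf (binmix t ?\<pi>) j / pmf (binmix t (point_mass p0)) j)\<^sup>2)
    = (\<Sum>j\<le>t. (pmf (binmix t ?\<pi>) j / pmf (binmix t (point_mass p0)) j)\<^sup>2 * pmf (binmix t (point_mass p0)) j)"
    by (rule integral_measure_pmf_real) (use set_pmf_binmix[OF \<pi>0, of t] in auto)
  also have "\<dots> = (\<Sum>j\<le>t. (pmf (binmix t ?\<pi>) j)\<^sup>2 / pmf (binmix t (point_mass p0)) j)"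
  proof (rule sum.cong)
    fix j assume "j \<in> {..t}"
    then have "pmf (binmix t (point_mass p0)) j > 0" by (intro b0) auto
    then show "(pmf (binmix t ?\<pi>) j / pmf (binmix t (point_mass p0)) j)\<^sup>2 * pmf (binmix t (point_mass p0)) j
      = (pmf (binmix t ?\<pi>) j)\<^sup>2 / pmf (binmix t (point_mass p0)) j"
      by (simp add: power_divide power2_eq_square)
  qed simp
  also have "(\<Prod>i<n. \<Sum>j\<le>t. (pmf (binmix t ?\<pi>) j)\<^sup>2 / pmf (binmix t (point_mass p0)) j) \<le> (\<Prod>i<n. 1 + y\<^sup>2)"
    using one by (intro prod_mono) (auto intro!: sum_nonneg)
  also have "\<dots> = (1 + y\<^sup>2) ^ n" by simp
  also have "\<dots> \<le> exp (y\<^sup>2) ^ n" by (intro power_mono) auto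
  also have "\<dots> = exp (real n * y\<^sup>2)" by (simp add: exp_of_nat_mult)
  also have "\<dots> \<le> exp (\<eta>\<^sup>2 / 2)" using ny by simp
  also have "\<dots> \<le> 1 + \<eta>\<^sup>2 / 2 + (\<eta>\<^sup>2 / 2)\<^sup>2" using \<eta>2 by (intro exp_bound) auto
  also have "\<dots> \<le> 1 + \<eta>\<^sup>2"
    using mult_left_le[of "\<eta>\<^sup>2 / 2" "\<eta>\<^sup>2 / 2"] \<eta>2 by (simp add: power2_eq_square[of "\<eta>\<^sup>2 / 2"])
  finally have chi: "(\<Sum>X\<in>samples n t. (pmf ?Q X)\<^sup>2 / pmf ?B X) \<le> 1 + \<eta>\<^sup>2" .
  have "sum (pmf ?B) (samples n t \<inter> A) - sum (pmf ?Q) (samples n t \<inter> A) \<le> \<eta>"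
  proof (rule chi_square_close[OF finite_samples _ pos _ _ \<eta>(1) chi])
    show "sum (pmf ?B) (samples n t) = 1"
      using set_pmf_binmix_prod[OF \<pi>0] finite_samples by (intro sum_pmf_eq_1) auto
    show "sum (pmf ?Q) (samples n t) = 1"
      using set_pmf_binmix_prod[OF \<pi>] finite_samples by (intro sum_pmf_eq_1) auto
  qed auto
  then show ?thesis
    unfolding prob_eq_sum_samples[OF set_pmf_binmix_prod[OF \<pi>0]] prob_eq_sum_samples[OF set_pmf_binmix_prod[OF \<pi>]]
    by simp
qed

lemma local_risk_gt_below_rate:
  assumes \<alpha>: "0 \<le> \<alpha>" and \<eta>: "0 < \<eta>" "\<eta> \<le> 1" and p0: "p0 \<in> {0..1}" and n: "n \<ge> 1" and t: "t \<ge> 1"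
    and \<epsilon>: "0 \<le> \<epsilon>" "\<epsilon> < (\<eta> / 2) * rate (p0 * (1 - p0)) n t"
  shows "1 - \<alpha> - \<eta> \<le> local_risk \<alpha> n t \<epsilon> (point_mass p0)"
proof -
  define \<mu> where "\<mu> = p0 * (1 - p0)"
  have "\<epsilon> < (\<eta> / 2) * (1 / real n) \<or> \<epsilon> < (\<eta> / 2) * min_rate \<mu> n t"
    using \<epsilon>(2) by (auto simp: rate_def \<mu>_def max_def split: if_splits)
  then show ?thesis
  proof
    assume h: "\<epsilon> < (\<eta> / 2) * (1 / real n)"
    \<comment> \<open>the end point of the unit interval farther from \<open>p0\<close>\<close>
    define e :: real where "e = (if p0 \<le> 1 / 2 then 1 else 0)"
    have e: "e \<in> {0..1}" "\<bar>e - p0\<bar> \<ge> 1 / 2" using p0 by (auto simp: e_def)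
    have w: "\<eta> / real n \<in> {0..1}" using n \<eta> by (auto simp: divide_simps)
    show ?thesis
    proof (rule local_risk_ge[OF \<alpha> p0 two_point_mixing_dists[OF e(1) p0] _
          contamination_close[OF n _ \<eta>(2) e(1) p0]])
      have "\<epsilon> \<le> \<eta> / real n * (1 / 2)" using h by simp
      also have "\<dots> \<le> \<eta> / real n * \<bar>e - p0\<bar>" using e \<eta> by (intro mult_left_mono) auto
      finally show "W1 (two_point (\<eta> / real n) e p0) (point_mass p0) \<ge> \<epsilon>"
        by (simp add: W1_two_point[OF e(1) p0 w p0])
    qed (use \<eta> in auto)
  next
    assume lt: "\<epsilon> < (\<eta> / 2) * min_rate \<mu> n t"
    define h where "h = (\<eta> / 2) * min_rate \<mu> n t"
    define \<rho> where "\<rho> = sqrt \<mu> / (sqrt (real t) * real n powr (1 / 4))"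
    have m: "min_rate \<mu> n t \<le> \<mu>" "min_rate \<mu> n t \<le> \<rho>" by (auto simp: min_rate_def \<rho>_def)
    have hpos: "h > 0" using lt \<epsilon> by (simp add: h_def)
    then have mpos: "min_rate \<mu> n t > 0" using \<eta> by (simp add: h_def zero_less_mult_iff)
    then have \<mu>: "\<mu> > 0" using m by linarith
    then have p0': "0 < p0" "p0 < 1" using p0 by (auto simp: \<mu>_def zero_less_mult_iff)
    have "h \<le> 1 * min_rate \<mu> n t" unfolding h_def using \<eta> mpos by (intro mult_right_mono) auto
    then have h\<mu>: "h \<le> \<mu>" using m by linarith
    have \<mu>b: "\<mu> \<le> p0" "\<mu> \<le> 1 - p0"
      using p0' by (auto simp: \<mu>_def mult_left_le mult_left_le_one_le)
    have r: "p0 + h \<in> {0..1}" "p0 - h \<in> {0..1}" and w: "(1 / 2 :: real) \<in> {0..1}"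
      using h\<mu> \<mu>b hpos p0' by auto
    have small: "real n * (real t * (h\<^sup>2 / \<mu>))\<^sup>2 \<le> \<eta>\<^sup>2 / 2"
    proof -
      have "h \<le> (\<eta> / 2) * \<rho>" unfolding h_def using m \<eta> by (intro mult_left_mono) auto
      then have "h\<^sup>2 \<le> ((\<eta> / 2) * \<rho>)\<^sup>2" using hpos by (intro power_mono) auto
      also have "\<dots> = (\<eta> / 2)\<^sup>2 * (\<mu> / (real t * sqrt (real n)))"
        unfolding \<rho>_def power_mult_distrib using \<mu> n by (subst square_root_rate) auto
      finally have "h\<^sup>2 / \<mu> \<le> (\<eta> / 2)\<^sup>2 * (\<mu> / (real t * sqrt (real n))) / \<mu>"
        using \<mu> by (intro divide_right_mono) auto
      then have "real t * (h\<^sup>2 / \<mu>) \<le> real t * ((\<eta> / 2)\<^sup>2 * (\<mu> / (real t * sqrt (real n))) / \<mu>)"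
        by (intro mult_left_mono) auto
      also have "\<dots> = (\<eta> / 2)\<^sup>2 / sqrt (real n)" using \<mu> t by simp
      finally have "(real t * (h\<^sup>2 / \<mu>))\<^sup>2 \<le> ((\<eta> / 2)\<^sup>2 / sqrt (real n))\<^sup>2"
        using \<mu> by (intro power_mono) auto
      also have "\<dots> = \<eta> ^ 4 / 16 / real n" by (simp add: power_divide flip: power_mult)
      finally have "real n * (real t * (h\<^sup>2 / \<mu>))\<^sup>2 \<le> real n * (\<eta> ^ 4 / 16 / real n)"
        by (intro mult_left_mono) auto
      also have "\<dots> = \<eta> ^ 4 / 16" using n by simp
      also have "\<dots> \<le> \<eta> ^ 2 / 2"
      proof -
        have "\<eta> ^ 4 \<le> \<eta> ^ 2" using \<eta> by (intro power_decreasing) auto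
        moreover have "0 \<le> \<eta> ^ 2" by simp
        ultimately show ?thesis by linarith
      qed
      finally show ?thesis .
    qed
    show ?thesis
    proof (rule local_risk_ge[OF \<alpha> p0 two_point_mixing_dists[OF r] _
          symmetric_pair_close[OF p0' n \<eta> _ h\<mu>[unfolded \<mu>_def] small[unfolded \<mu>_def]]])
      show "W1 (two_point (1 / 2) (p0 + h) (p0 - h)) (point_mass p0) \<ge> \<epsilon>"
        using lt[folded h_def] hpos by (simp add: W1_two_point[OF r w p0])
    qed (use hpos in simp)
  qed
qed

section \<open>Bounds on the critical separation\<close>

lemma max_type2_nonneg: "0 \<le> max_type2 n t \<pi>0 \<psi> \<epsilon>"
  unfolding max_type2_def by (rule cSup_upper) (auto intro!: bdd_aboveI[of _ 1])

lemma local_risk_le: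
  assumes "\<psi> \<in> level_tests \<alpha> n t \<pi>0" "max_type2 n t \<pi>0 \<psi> \<epsilon> \<le> b"
  shows "local_risk \<alpha> n t \<epsilon> \<pi>0 \<le> b"
proof -
  have "local_risk \<alpha> n t \<epsilon> \<pi>0 \<le> max_type2 n t \<pi>0 \<psi> \<epsilon>"
    unfolding local_risk_def using assms(1)
    by (intro cINF_lower bdd_belowI2[of _ 0] max_type2_nonneg)
  then show ?thesis using assms(2) by linarith
qed

lemma psi_LM_level_tests:
  assumes "p0 \<in> {0..1}" "\<alpha> \<ge> 0"
  shows "psi_LM n t \<alpha> p0 \<in> level_tests \<alpha> n t (point_mass p0)"
  using psi_LM_level[OF assms, of n t]
  by (auto simp: level_tests_def tests_def psi_LM_def psi_LM_lower_def psi_def)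

lemma crit_sep_bounds:
  assumes \<alpha>: "0 < \<alpha>" "\<alpha> < 1" and \<beta>: "0 < \<beta>" "\<beta> < 1 - \<alpha>"
    and C: "C \<ge> 8" "32 / C \<le> \<alpha>" "2226 / C \<le> \<beta>"
    and p0: "p0 \<in> {0..1}" and n: "n \<ge> 1" and t: "t \<ge> 2"
  defines "r \<equiv> rate (p0 * (1 - p0)) n t"
  shows "(1 - \<alpha> - \<beta>) / 4 * r \<le> crit_sep \<alpha> \<beta> n t (point_mass p0)"
    and "crit_sep \<alpha> \<beta> n t (point_mass p0) \<le> 2 * C * r"
proof -
  let ?E = "{\<epsilon>. 0 \<le> \<epsilon> \<and> local_risk \<alpha> n t \<epsilon> (point_mass p0) \<le> \<beta>}"
  have "1 / real n \<ge> 0" by simp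
  then have r: "r \<ge> 0" unfolding r_def rate_def by linarith
  have in_E: "2 * C * r \<in> ?E"
  proof -
    have "max_type2 n t (point_mass p0) (psi_LM n t \<alpha> p0) (2 * C * r) \<le> \<beta>"
      using C \<alpha> unfolding r_def by (intro max_type2_psi_LM_le[OF p0 n t C(1,2)]) auto
    then have "local_risk \<alpha> n t (2 * C * r) (point_mass p0) \<le> \<beta>"
      using \<alpha> p0 by (intro local_risk_le[OF psi_LM_level_tests]) auto
    then show ?thesis using r C by simp
  qed
  show "crit_sep \<alpha> \<beta> n t (point_mass p0) \<le> 2 * C * r"
    unfolding crit_sep_def using in_E by (intro cInf_lower bdd_belowI[of _ 0]) auto
  show "(1 - \<alpha> - \<beta>) / 4 * r \<le> crit_sep \<alpha> \<beta> n t (point_mass p0)"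
    unfolding crit_sep_def
  proof (rule cInf_greatest)
    show "?E \<noteq> {}" using in_E by blast
    fix \<epsilon> assume e: "\<epsilon> \<in> ?E"
    define \<eta> where "\<eta> = (1 - \<alpha> - \<beta>) / 2"
    have \<eta>: "0 < \<eta>" "\<eta> \<le> 1" using \<alpha> \<beta> by (auto simp: \<eta>_def)
    show "(1 - \<alpha> - \<beta>) / 4 * r \<le> \<epsilon>"
    proof (rule ccontr)
      assume "\<not> (1 - \<alpha> - \<beta>) / 4 * r \<le> \<epsilon>"
      then have "\<epsilon> < (\<eta> / 2) * r" by (simp add: \<eta>_def)
      then have "1 - \<alpha> - \<eta> \<le> local_risk \<alpha> n t \<epsilon> (point_mass p0)"
        using e \<alpha> t unfolding r_def by (intro local_risk_gt_below_rate[OF _ \<eta> p0 n]) auto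
      moreover have "1 - \<alpha> - \<eta> = \<beta> + \<eta>" by (simp add: \<eta>_def field_simps)
      ultimately show False using e \<eta> by simp
    qed
  qed
qed

text \<open>
  If the root term \<open>\<rho>\<close> exceeds \<open>\<mu>\<close>, then \<open>\<rho>\<^sup>2 = \<mu> / (t \<surd>n)\<close> gives
  \<open>\<rho> \<le> 1 / (t \<surd>n)\<close>, which is at most \<open>1 / (c n)\<close> for \<open>t \<ge> c \<surd>n\<close>. Hence the minimum with \<open>\<mu>\<close>
  only matters where both terms are at most \<open>1 / (c n)\<close>.
\<close>

lemma rate_le_for_large_t:
  assumes \<mu>: "\<mu> \<ge> 0" and n: "n \<ge> 1" and t: "t \<ge> 1" and c: "c > 0" and tc: "real t \<ge> c * sqrt (real n)"
  defines "r \<equiv> max (1 / real n) (sqrt \<mu> / (sqrt (real t) * real n powr (1 / 4)))"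
  shows "rate \<mu> n t \<le> r" and "r \<le> max 1 (1 / c) * rate \<mu> n t"
proof -
  define \<rho> where "\<rho> = sqrt \<mu> / (sqrt (real t) * real n powr (1 / 4))"
  show "rate \<mu> n t \<le> r" by (auto simp: rate_def min_rate_def r_def)
  have r1: "rate \<mu> n t \<ge> 1 / real n" by (simp add: rate_def)
  have npos: "1 / real n > 0" using n by simp
  with r1 have rpos: "rate \<mu> n t > 0" by linarith
  have \<rho>0: "\<rho> \<ge> 0" using \<mu> by (simp add: \<rho>_def)
  have up: "rate \<mu> n t \<le> max 1 (1 / c) * rate \<mu> n t"
    using mult_right_mono[of 1 "max 1 (1 / c)" "rate \<mu> n t"] rpos by simp
  have "\<rho> \<le> max 1 (1 / c) * rate \<mu> n t"
  proof (cases "\<rho> \<le> \<mu>")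
    case True
    then have "\<rho> \<le> rate \<mu> n t" by (auto simp: rate_def min_rate_def \<rho>_def)
    then show ?thesis using up by linarith
  next
    case False
    define z where "z = 1 / (real t * sqrt (real n))"
    have z: "z > 0" using n t by (simp add: z_def)
    have sq: "\<rho>\<^sup>2 = \<mu> * z"
      unfolding \<rho>_def using square_root_rate[OF \<mu> n, of t] by (simp add: z_def)
    have "\<rho> * \<rho> \<le> \<rho> * z"
      using sq False z by (simp add: power2_eq_square mult_right_mono)
    then have "\<rho> \<le> z" using \<rho>0 z by (cases "\<rho> = 0") auto
    also have "z \<le> 1 / ((c * sqrt (real n)) * sqrt (real n))"
      unfolding z_def using tc c n t by (intro divide_left_mono mult_right_mono) auto
    also have "\<dots> = (1 / c) * (1 / real n)" by simp
    also have "\<dots> \<le> max 1 (1 / c) * rate \<mu> n t"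
      using r1 c npos by (intro mult_mono) auto
    finally show ?thesis .
  qed
  then show "r \<le> max 1 (1 / c) * rate \<mu> n t"
    unfolding r_def \<rho>_def[symmetric] using r1 up by simp
qed

theorem theorem4:
  fixes \<alpha> \<beta> :: real
  assumes "0 < \<alpha>" "\<alpha> < 1" "0 < \<beta>" "\<beta> < 1 - \<alpha>"
  shows
    "(\<forall>n\<ge>1. \<forall>t\<ge>2. \<forall>p0\<in>{0..1}.
        measure_pmf.prob (binmix_prod n t (point_mass p0)) {X. psi_LM n t \<alpha> p0 X = 1} \<le> \<alpha>)
   \<and> (\<exists>C>0. \<exists>N. \<forall>n\<ge>N. \<forall>t\<ge>2. \<forall>p0\<in>{0..1}. \<forall>\<epsilon>.
        \<epsilon> \<ge> C * crit_sep \<alpha> \<beta> n t (point_mass p0) \<longrightarrow>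
        max_type2 n t (point_mass p0) (psi_LM n t \<alpha> p0) \<epsilon> \<le> \<beta>)
   \<and> (\<forall>c>0. \<exists>c1>0. \<exists>c2>0. \<exists>N. \<forall>n\<ge>N. \<forall>t\<ge>2. \<forall>p0\<in>{0..1}.
        real t \<ge> c * sqrt (real n) \<longrightarrow>
        (let \<mu> = p0 * (1 - p0);
             r = max (1 / real n) (sqrt \<mu> / (sqrt (real t) * real n powr (1 / 4)))
         in c1 * r \<le> crit_sep \<alpha> \<beta> n t (point_mass p0) \<and>
            crit_sep \<alpha> \<beta> n t (point_mass p0) \<le> c2 * r))
   \<and> (\<forall>c>0. \<exists>c1>0. \<exists>c2>0. \<exists>N. \<forall>n\<ge>N. \<forall>t\<ge>2. \<forall>p0\<in>{0..1}.
        real t \<le> c * sqrt (real n) \<longrightarrow>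
        (let \<mu> = p0 * (1 - p0);
             r = max (1 / real n) (min \<mu> (sqrt \<mu> / (sqrt (real t) * real n powr (1 / 4))))
         in c1 * r \<le> crit_sep \<alpha> \<beta> n t (point_mass p0) \<and>
            crit_sep \<alpha> \<beta> n t (point_mass p0) \<le> c2 * r))"
proof -
  define C where "C = max 8 (max (32 / \<alpha>) (2226 / \<beta>))"
  have "C \<ge> 8" "C \<ge> 32 / \<alpha>" "C \<ge> 2226 / \<beta>" by (auto simp: C_def)
  then have C: "C \<ge> 8" "32 / C \<le> \<alpha>" "2226 / C \<le> \<beta>"
    using assms by (auto simp: field_simps)
  define c0 where "c0 = (1 - \<alpha> - \<beta>) / 4"
  have c0: "c0 > 0" using assms by (simp add: c0_def)
  have lower: "c0 * rate (p0 * (1 - p0)) n t \<le> crit_sep \<alpha> \<beta> n t (point_mass p0)"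
    and upper: "crit_sep \<alpha> \<beta> n t (point_mass p0) \<le> 2 * C * rate (p0 * (1 - p0)) n t"
    if "n \<ge> 1" "t \<ge> 2" "p0 \<in> {0..1}" for n t p0
    using crit_sep_bounds[OF assms C that(3,1,2)] by (auto simp: c0_def)
  show ?thesis
  proof (intro conjI)
    show "\<forall>n\<ge>1. \<forall>t\<ge>2. \<forall>p0\<in>{0..1}.
        measure_pmf.prob (binmix_prod n t (point_mass p0)) {X. psi_LM n t \<alpha> p0 X = 1} \<le> \<alpha>"
      using psi_LM_level assms(1) by simp
    show "\<exists>C>0. \<exists>N. \<forall>n\<ge>N. \<forall>t\<ge>2. \<forall>p0\<in>{0..1}. \<forall>\<epsilon>.
        \<epsilon> \<ge> C * crit_sep \<alpha> \<beta> n t (point_mass p0) \<longrightarrow>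
        max_type2 n t (point_mass p0) (psi_LM n t \<alpha> p0) \<epsilon> \<le> \<beta>"
    \<comment> \<open>the error is at most \<open>\<beta>\<close> from \<open>2 * C * rate\<close> on, and the critical separation is at least \<open>c0 * rate\<close>\<close>
    proof (intro exI[of _ "2 * C / c0"] exI[of _ 1] conjI allI impI ballI)
      show "2 * C / c0 > 0" using C c0 by simp
      fix n t :: nat and p0 \<epsilon> :: real
      assume n: "n \<ge> 1" and t: "t \<ge> 2" and p0: "p0 \<in> {0..1}"
        and e: "\<epsilon> \<ge> 2 * C / c0 * crit_sep \<alpha> \<beta> n t (point_mass p0)"
      have "2 * C * rate (p0 * (1 - p0)) n t = 2 * C / c0 * (c0 * rate (p0 * (1 - p0)) n t)"
        using c0 by simp
      also have "\<dots> \<le> 2 * C / c0 * crit_sep \<alpha> \<beta> n t (point_mass p0)"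
        using C c0 by (intro mult_left_mono lower[OF n t p0]) auto
      also note e
      finally show "max_type2 n t (point_mass p0) (psi_LM n t \<alpha> p0) \<epsilon> \<le> \<beta>"
        by (rule max_type2_psi_LM_le[OF p0 n t C(1,2) assms(2) C(3)])
    qed
    show "\<forall>c>0. \<exists>c1>0. \<exists>c2>0. \<exists>N. \<forall>n\<ge>N. \<forall>t\<ge>2. \<forall>p0\<in>{0..1}.
        real t \<ge> c * sqrt (real n) \<longrightarrow>
        (let \<mu> = p0 * (1 - p0);
             r = max (1 / real n) (sqrt \<mu> / (sqrt (real t) * real n powr (1 / 4)))
         in c1 * r \<le> crit_sep \<alpha> \<beta> n t (point_mass p0) \<and>
            crit_sep \<alpha> \<beta> n t (point_mass p0) \<le> c2 * r)"
    proof (intro allI impI)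
      fix c :: real assume c: "c > 0"
      define K where "K = max 1 (1 / c)"
      have K: "K \<ge> 1" by (simp add: K_def)
      show "\<exists>c1>0. \<exists>c2>0. \<exists>N. \<forall>n\<ge>N. \<forall>t\<ge>2. \<forall>p0\<in>{0..1}.
        real t \<ge> c * sqrt (real n) \<longrightarrow>
        (let \<mu> = p0 * (1 - p0);
             r = max (1 / real n) (sqrt \<mu> / (sqrt (real t) * real n powr (1 / 4)))
         in c1 * r \<le> crit_sep \<alpha> \<beta> n t (point_mass p0) \<and>
            crit_sep \<alpha> \<beta> n t (point_mass p0) \<le> c2 * r)"
      proof (rule exI[of _ "c0 / K"], rule conjI[OF _ exI[of _ "2 * C"], OF _ conjI[OF _ exI[of _ 1]]],
          goal_cases)
        case 1
        show ?case using c0 K by simp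
      next
        case 2
        show ?case using C by simp
      next
        case 3
        show ?case unfolding Let_def
        proof (intro allI ballI impI)
          fix n t :: nat and p0 :: real
          assume n: "n \<ge> 1" and t: "t \<ge> 2" and p0: "p0 \<in> {0..1}" and tc: "real t \<ge> c * sqrt (real n)"
          let ?\<mu> = "p0 * (1 - p0)"
          let ?r = "max (1 / real n) (sqrt ?\<mu> / (sqrt (real t) * real n powr (1 / 4)))"
          have \<mu>: "?\<mu> \<ge> 0" using p0 by simp
          have d: "rate ?\<mu> n t \<le> ?r" "?r \<le> K * rate ?\<mu> n t"
            using rate_le_for_large_t[OF \<mu> n _ c tc] t by (auto simp: K_def)
          have "c0 / K * ?r \<le> c0 / K * (K * rate ?\<mu> n t)"
            using c0 K by (intro mult_left_mono d(2)) auto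
          also have "\<dots> = c0 * rate ?\<mu> n t" using K by simp
          also have "\<dots> \<le> crit_sep \<alpha> \<beta> n t (point_mass p0)" by (rule lower[OF n t p0])
          finally have L: "c0 / K * ?r \<le> crit_sep \<alpha> \<beta> n t (point_mass p0)" .
          have "2 * C * rate ?\<mu> n t \<le> 2 * C * ?r" using C by (intro mult_left_mono d(1)) auto
          then have U: "crit_sep \<alpha> \<beta> n t (point_mass p0) \<le> 2 * C * ?r"
            using upper[OF n t p0] by linarith
          show "c0 / K * ?r \<le> crit_sep \<alpha> \<beta> n t (point_mass p0) \<and>
              crit_sep \<alpha> \<beta> n t (point_mass p0) \<le> 2 * C * ?r" using L U by (rule conjI)
        qed
      qed
    qed
    show "\<forall>c>0. \<exists>c1>0. \<exists>c2>0. \<exists>N. \<forall>n\<ge>N. \<forall>t\<ge>2. \<forall>p0\<in>{0..1}.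
        real t \<le> c * sqrt (real n) \<longrightarrow>
        (let \<mu> = p0 * (1 - p0);
             r = max (1 / real n) (min \<mu> (sqrt \<mu> / (sqrt (real t) * real n powr (1 / 4))))
         in c1 * r \<le> crit_sep \<alpha> \<beta> n t (point_mass p0) \<and>
            crit_sep \<alpha> \<beta> n t (point_mass p0) \<le> c2 * r)"
    proof (intro allI impI)
      fix c :: real assume "c > 0"
      show "\<exists>c1>0. \<exists>c2>0. \<exists>N. \<forall>n\<ge>N. \<forall>t\<ge>2. \<forall>p0\<in>{0..1}.
        real t \<le> c * sqrt (real n) \<longrightarrow>
        (let \<mu> = p0 * (1 - p0);
             r = max (1 / real n) (min \<mu> (sqrt \<mu> / (sqrt (real t) * real n powr (1 / 4))))
         in c1 * r \<le> crit_sep \<alpha> \<beta> n t (point_mass p0) \<and>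
            crit_sep \<alpha> \<beta> n t (point_mass p0) \<le> c2 * r)"
      proof (rule exI[of _ c0], rule conjI[OF c0], rule exI[of _ "2 * C"], rule conjI, goal_cases)
        case 1
        show ?case using C by simp
      next
        case 2
        show ?case
          \<comment> \<open>the expression is \<open>rate\<close> itself, whose bounds hold for every \<open>t\<close>\<close>
          using lower upper unfolding rate_def min_rate_def Let_def by (intro exI[of _ 1]) auto
      qed
    qed
  qed
qed

end
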